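(* Consider the discrete-time LPV system $x_{k+1}=A(p_k)x_k+B(p_k)u_k$ with affine $A(p)=A_0+\sum_{i=1}^{n_p}p_iA_i$, $B(p)=B_0+\sum_{i=1}^{n_p}p_iB_i$, and a data set $\mathcal{D}$ from it such that $\mathcal{D}_p$ has full row rank $(1+n_p)(n_x+n_u)$. Let $\gamma>0$, $Q\succeq0$, $R\succ0$. Suppose there exist $P\in\mathbb{S}^{n_x}$ with $P\succ0$, $\Xi\in\mathbb{S}^{4n_pn_x}$, $F_Q\in\mathbb{R}^{(N_d-1)(1+n_p)\times n_x(1+n_p)}$ with an associated $\mathcal{F}\in\mathbb{R}^{(N_d-1)\times n_x(1+n_p+n_p^2)}$ satisfying $\mathcal{F}[I_{n_x};\,p\otimes I_{n_x};\,p\otimes p\otimes I_{n_x}]=[I_{N_d-1};\,p\otimes I_{N_d-1}]^\top F_Q[I_{n_x};\,p\otimes I_{n_x}]$ for all $p\in\mathbb{P}$, and $\mathcal{Y}=[Y_0\ \bar Y]$ with $Y_0\in\mathbb{R}^{n_u\times n_x}$, $\bar Y\in\mathbb{R}^{n_u\times n_xn_p}$, such that $$\begin{bmatrix}P&0&0\\0&I_{n_p}\otimes P&0\\ Y_0&\bar Y&0\\ 0& I_{n_p}\otimes Y_0& I_{n_p}\otimes\bar Y\end{bmatrix}=\mathcal{D}_p\mathcal{F}$$ and the full-block LMI conditions (defined in the context) hold for all $p\in\mathbb{P}$ with $\Delta(p)=\mathrm{diag}(p)\otimes I_{2n_x}$, $$W=\begin{bmatrix}P_0&(\mathcal{X}_+F_Q)^\top&[Q^{1/2}P\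 \ 0]^\top&(R^{1/2}\mathcal{Y})^\top&0\\ \mathcal{X}_+F_Q&P_0&0&0&[I_{n_x}\ 0]^\top\\ [Q^{1/2}P\ \ 0]&0&\gamma I_{n_x}&0&0\\ R^{1/2}\mathcal{Y}&0&0&\gamma I_{n_u}&0\\ 0&[I_{n_x}\ 0]&0&0&\gamma I_{n_x}\end{bmatrix},$$ $P_0=\mathrm{blkdiag}(P,0_{n_xn_p})$, $\mathcal{X}_+=\mathrm{blkdiag}(X_+,I_{n_p}\otimes X_+)$, $L_{11}=0_{2n_xn_p}$, $L_{12}=[1_{n_p}\otimes I_{2n_x}\ \ 0_{2n_xn_p\times(2n_x+n_u)}]$, $L_{21}=\begin{bmatrix}0_{n_x\times 2n_xn_p}\\ I_{n_p}\otimes[I_{n_x}\ 0]\\ 0_{n_x\times 2n_xn_p}\\ I_{n_p}\otimes[0\ I_{n_x}]\\ 0_{(2n_x+n_u)\times 2n_xn_p}\end{bmatrix}$, $L_{22}=\begin{bmatrix}[I_{n_x}\ 0]&0\\ 1_{n_p}\otimes 0_{n_x\times 2n_x}&0\\ [0\ I_{n_x}]&0\\ 1_{n_p}\otimes 0_{n_x\times 2n_x}&0\\ 0&I_{2n_x+n_u}\end{bmatrix}$. Then the LPV state-feedback controller $K(p)=K_0+\sum_{i=1}^{n_p}p_iK_i$ with $K_0=Y_0P^{-1}$, $[K_1\ \cdots\ K_{n_p}]=\bar Y(I_{n_p}\otimes P)^{-1}$ stabilizes the system and the closed-loop generalized plant $x_{k+1}=(A(p_k)+B(p_k)K(p_k))x_k+w_k$,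 $z_k=\begin{bmatrix}Q^{1/2}\\ R^{1/2}K(p_k)\end{bmatrix}x_k$ has $\ell_2$-gain less than $\gamma$.
   Context: Notation: $\otimes$ Kronecker product; $I_n$ identity; $0_{n\times m}$, $0_n$ zero matrices; $1_n$ the all-ones vector; $\mathbb{S}^n$ real symmetric matrices; $\mathrm{blkdiag}$ block-diagonal concatenation; $\mathrm{diag}(p)$ diagonal matrix of entries of $p$; $[a;b]$ vertical stacking. The system has fully measured state $x_k\in\mathbb{R}^{n_x}$, input $u_k\in\mathbb{R}^{n_u}$, scheduling $p_k\in\mathbb{P}\subset\mathbb{R}^{n_p}$, $\mathbb{P}$ compact and convex; $A_i,B_i$ unknown real matrices. $\mathcal{D}=\{u^d_k,p^d_k,x^d_k\}_{k=1}^{N_d}$ is a trajectory of the system; $U=[u^d_1\cdots u^d_{N_d-1}]$, $U^p=[p^d_1\otimes u^d_1\cdots p^d_{N_d-1}\otimes u^d_{N_d-1}]$, $X=[x^d_1\cdots x^d_{N_d-1}]$, $X^p=[p^d_1\otimes x^d_1\cdots p^d_{N_d-1}\otimes x^d_{N_d-1}]$, $X_+=[x^d_2\cdots x^d_{N_d}]$, $\mathcal{D}_p=[X^\top\ (X^p)^\top\ U^\top\ (U^p)^\top]^\top$. Stabilizing means asymptotic stability of $x_{k+1}=(A(p_k)+B(p_k)K(p_k))x_k$ for all scheduling trajectories in $\mathbb{P}$. The $\ell_2$-gain of the plant is the infimum of $\gamma>0$ such that $\|z\|_2\le\gamma\|w\|_2$ for all its trajectories with $x_0=0$ (and all scheduling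 trajectories in $\mathbb{P}$), where $\|\cdot\|_2$ is the $\ell_2$-norm of a signal. Full-block LMI conditions for given $(\Delta(p),W,L_{11},L_{12},L_{21},L_{22})$ and symmetric $\Xi$: $\begin{bmatrix}L_{11}&L_{12}\\ I&0\end{bmatrix}^\top\Xi\begin{bmatrix}L_{11}&L_{12}\\ I&0\end{bmatrix}-\begin{bmatrix}L_{21}&L_{22}\end{bmatrix}^\top W\begin{bmatrix}L_{21}&L_{22}\end{bmatrix}\prec0$ and $\begin{bmatrix}I\\ \Delta(p)\end{bmatrix}^\top\Xi\begin{bmatrix}I\\ \Delta(p)\end{bmatrix}\succeq0$ for all $p\in\mathbb{P}$. *)

theory Defs
  imports Complex_Main "Jordan_Normal_Form.DL_Rank" "HOL-Library.Extended_Real"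
begin

definition hcat :: "real mat \<Rightarrow> real mat \<Rightarrow> real mat" where
  "hcat A B = mat (dim_row A) (dim_col A + dim_col B)
     (\<lambda>(i,j). if j < dim_col A then A $$ (i,j) else B $$ (i, j - dim_col A))"

definition vcat :: "real mat \<Rightarrow> real mat \<Rightarrow> real mat" where
  "vcat A B = mat (dim_row A + dim_row B) (dim_col A)
     (\<lambda>(i,j). if i < dim_row A then A $$ (i,j) else B $$ (i - dim_row A, j))"

fun hcats :: "real mat list \<Rightarrow> real mat" where
  "hcats [] = 0\<^sub>m 0 0"
| "hcats [A] = A"
| "hcats (A # As) = hcat A (hcats As)"

fun vcats :: "real mat list \<Rightarrow> real mat" where
  "vcats [] = 0\<^sub>m 0 0"
| "vcats [A] = A"
| "vcats (A # As) = vcat A (vcats As)"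

definition blockmat :: "real mat list list \<Rightarrow> real mat" where
  "blockmat rs = vcats (map hcats rs)"

definition blkdiag :: "real mat \<Rightarrow> real mat \<Rightarrow> real mat" where
  "blkdiag A B = blockmat [[A, 0\<^sub>m (dim_row A) (dim_col B)], [0\<^sub>m (dim_row B) (dim_col A), B]]"

definition kron :: "real mat \<Rightarrow> real mat \<Rightarrow> real mat" where
  "kron A B = mat (dim_row A * dim_row B) (dim_col A * dim_col B)
     (\<lambda>(i,j). A $$ (i div dim_row B, j div dim_col B) * B $$ (i mod dim_row B, j mod dim_col B))"

definition kron_vec :: "real vec \<Rightarrow> real vec \<Rightarrow> real vec" where
  "kron_vec v w = vec (dim_vec v * dim_vec w) (\<lambda>i. v $ (i div dim_vec w) * w $ (i mod dim_vec w))"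

definition colmat :: "real vec \<Rightarrow> real mat" where
  "colmat v = mat_of_cols (dim_vec v) [v]"

definition ones :: "nat \<Rightarrow> real mat" where
  "ones n = mat n 1 (\<lambda>_. 1)"

definition sym_mat :: "real mat \<Rightarrow> bool" where
  "sym_mat M \<longleftrightarrow> square_mat M \<and> transpose_mat M = M"

definition psd :: "real mat \<Rightarrow> bool" where
  "psd M \<longleftrightarrow> sym_mat M \<and> (\<forall>v \<in> carrier_vec (dim_row M). 0 \<le> v \<bullet> (M *\<^sub>v v))"

definition pd :: "real mat \<Rightarrow> bool" where
  "pd M \<longleftrightarrow> sym_mat M \<and>
     (\<forall>v \<in> carrier_vec (dim_row M). v \<noteq> 0\<^sub>v (dim_row M) \<longrightarrow> 0 < v \<bullet> (M *\<^sub>v v))"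

definition nd :: "real mat \<Rightarrow> bool" where
  "nd M \<longleftrightarrow> pd (- M)"

definition msqrt :: "real mat \<Rightarrow> real mat" where
  "msqrt M = (THE S. psd S \<and> dim_row S = dim_row M \<and> S * S = M)"

definition minv :: "real mat \<Rightarrow> real mat" where
  "minv A = (SOME B. B \<in> carrier_mat (dim_row A) (dim_row A) \<and> inverts_mat A B \<and> inverts_mat B A)"

definition vnorm :: "real vec \<Rightarrow> real" where
  "vnorm v = sqrt (v \<bullet> v)"

text \<open>Affine parameter dependence M(p) = M_0 + sum_{i=1}^{np} p_i M_i, where the
  scheduling vector p has components p $ 0, ..., p $ (np-1) (so p_i = p $ (i-1)).\<close>
definition aff :: "(nat \<Rightarrow> real mat) \<Rightarrow> nat \<Rightarrow> real vec \<Rightarrow> real mat" where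
  "aff M np p = mat (dim_row (M 0)) (dim_col (M 0))
     (\<lambda>ij. M 0 $$ ij + (\<Sum>i = 1..np. p $ (i - 1) * M i $$ ij))"

definition compact_convex_sched :: "nat \<Rightarrow> real vec set \<Rightarrow> bool" where
  "compact_convex_sched np PP \<longleftrightarrow>
     PP \<subseteq> carrier_vec np
   \<and> (\<exists>M. \<forall>p\<in>PP. \<forall>i<np. \<bar>p $ i\<bar> \<le> M)
   \<and> (\<forall>s q. (\<forall>k. s k \<in> PP) \<and> q \<in> carrier_vec np \<and> (\<forall>i<np. (\<lambda>k. s k $ i) \<longlonglongrightarrow> q $ i) \<longrightarrow> q \<in> PP)
   \<and> (\<forall>p\<in>PP. \<forall>q\<in>PP. \<forall>t::real. 0 \<le> t \<and> t \<le> 1 \<longrightarrow> t \<cdot>\<^sub>v p + (1 - t) \<cdot>\<^sub>v q \<in> PP)"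

fun traj :: "(real vec \<Rightarrow> real mat) \<Rightarrow> (nat \<Rightarrow> real vec) \<Rightarrow> (nat \<Rightarrow> real vec) \<Rightarrow> real vec \<Rightarrow> nat \<Rightarrow> real vec" where
  "traj Acl ps w x0 0 = x0"
| "traj Acl ps w x0 (Suc k) = Acl (ps k) *\<^sub>v traj Acl ps w x0 k + w k"

definition stabilizing :: "nat \<Rightarrow> real vec set \<Rightarrow> (real vec \<Rightarrow> real mat) \<Rightarrow> bool" where
  "stabilizing nx PP Acl \<longleftrightarrow>
    (\<forall>ps. (\<forall>k. ps k \<in> PP) \<longrightarrow>
       (\<forall>\<epsilon>>0. \<exists>\<delta>>0. \<forall>x0\<in>carrier_vec nx. vnorm x0 < \<delta> \<longrightarrow>
            (\<forall>k. vnorm (traj Acl ps (\<lambda>_. 0\<^sub>v nx) x0 k) < \<epsilon>))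
     \<and> (\<exists>\<delta>>0. \<forall>x0\<in>carrier_vec nx. vnorm x0 < \<delta> \<longrightarrow>
            (\<lambda>k. vnorm (traj Acl ps (\<lambda>_. 0\<^sub>v nx) x0 k)) \<longlonglongrightarrow> 0))"

text \<open>g bounds the l2-gain of x_{k+1} = Acl(p_k)x_k + w_k, z_k = Cz(p_k) x_k, x_0 = 0:
  ||z||_2 \<le> g ||w||_2 for all w in l2 and all scheduling trajectories in PP
  (||z||_2 is written as the supremum of its partial sums, so it may be infinite).\<close>
definition l2_gain_bound :: "nat \<Rightarrow> real vec set \<Rightarrow> (real vec \<Rightarrow> real mat) \<Rightarrow> (real vec \<Rightarrow> real mat) \<Rightarrow> real \<Rightarrow> bool" where
  "l2_gain_bound nx PP Acl Cz g \<longleftrightarrow>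
    (\<forall>ps w. (\<forall>k. ps k \<in> PP) \<longrightarrow> (\<forall>k. w k \<in> carrier_vec nx) \<longrightarrow> summable (\<lambda>k. vnorm (w k) ^ 2) \<longrightarrow>
       (\<forall>N. sqrt (\<Sum>k<N. vnorm (Cz (ps k) *\<^sub>v traj Acl ps w (0\<^sub>v nx) k) ^ 2)
             \<le> g * sqrt (\<Sum>k. vnorm (w k) ^ 2)))"

definition l2_gain :: "nat \<Rightarrow> real vec set \<Rightarrow> (real vec \<Rightarrow> real mat) \<Rightarrow> (real vec \<Rightarrow> real mat) \<Rightarrow> ereal" where
  "l2_gain nx PP Acl Cz = Inf (ereal ` {g. g > 0 \<and> l2_gain_bound nx PP Acl Cz g})"

definition Umat :: "nat \<Rightarrow> nat \<Rightarrow> (nat \<Rightarrow> real vec) \<Rightarrow> real mat" where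
  "Umat nu Nd ud = mat_of_cols nu (map ud [1..<Nd])"

definition Upmat :: "nat \<Rightarrow> nat \<Rightarrow> nat \<Rightarrow> (nat \<Rightarrow> real vec) \<Rightarrow> (nat \<Rightarrow> real vec) \<Rightarrow> real mat" where
  "Upmat np nu Nd ps_d ud = mat_of_cols (np * nu) (map (\<lambda>k. kron_vec (ps_d k) (ud k)) [1..<Nd])"

definition Xplus :: "nat \<Rightarrow> nat \<Rightarrow> (nat \<Rightarrow> real vec) \<Rightarrow> real mat" where
  "Xplus nx Nd xd = mat_of_cols nx (map xd [2..<Nd + 1])"

definition Dp :: "nat \<Rightarrow> nat \<Rightarrow> nat \<Rightarrow> nat \<Rightarrow> (nat \<Rightarrow> real vec) \<Rightarrow> (nat \<Rightarrow> real vec) \<Rightarrow> (nat \<Rightarrow> real vec) \<Rightarrow> real mat" where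
  "Dp nx nu np Nd ud ps_d xd = vcats [Umat nx Nd xd, Upmat np nx Nd ps_d xd, Umat nu Nd ud, Upmat np nu Nd ps_d ud]"

end

theory Submission
  imports Defs "Jordan_Normal_Form.Spectral_Radius"
begin

text \<open>The lifted identities for \<open>F\<^sub>Q\<close>, \<open>\<F>\<close> and the data matrices give
  \<open>[I; p \<otimes> I]\<^sup>T X\<^sub>+ F\<^sub>Q [I; p \<otimes> I] = (A(p) + B(p) K(p)) P\<close>, where the calligraphic \<open>X\<^sub>+\<close> is the block
  diagonal one. The full-block S-procedure then turns the two LMI conditions into a single bound
  \<open>\<epsilon> \<bar>v\<bar>\<^sup>2 \<le> v\<^sup>T M(p) v\<close>, with \<open>M(p)\<close> the matrix \<open>W\<close> compressed to \<open>[I; p \<otimes> I]\<close>, uniform in \<open>p\<close> because the first LMI does not depend on \<open>p\<close>. Evaluating it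
  at a suitable \<open>v\<close> shows that \<open>V(x) = x\<^sup>T P\<^sup>-\<^sup>1 x\<close> satisfies
  \<open>V(x\<^sub>k\<^sub>+\<^sub>1) + \<bar>z\<^sub>k\<bar>\<^sup>2 / \<gamma> \<le> V(x\<^sub>k) + (\<gamma> - \<epsilon>) \<bar>w\<^sub>k\<bar>\<^sup>2 - \<delta> \<bar>x\<^sub>k\<bar>\<^sup>2\<close>, which yields
  exponential stability and, after summation, the gain bound \<open>sqrt (\<gamma> (\<gamma> - \<epsilon>)) < \<gamma>\<close>.\<close>

subsection \<open>Orthogonal diagonalization of real symmetric matrices\<close>

text \<open>The obstacle is that \<open>P0\<close> = blkdiag(P, 0) is singular as soon as the lifted
  part is nonempty, so \<open>W\<close> cannot be treated by Schur complements in the lifted space.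
  It is therefore only ever evaluated on lifted vectors [a; p \<otimes> a], on which
  \<open>P0\<close> acts as P. For the same reason the product of the data matrix with
  \<open>FQ\<close> is never computed: the identity linking \<open>FQ\<close> and \<open>FF\<close>
  determines exactly its bilinear form between two lifted vectors, which is all that such an
  evaluation sees. The decision variable P is the inverse of the Lyapunov matrix, hence the
  substitution a = P^-1 x. The spectral theorem serves three purposes: the positive margin hidden in
  a strict LMI, the two-sided bounds on V, and the shape of \<open>msqrt\<close>, which is a
  definite description and so has no known dimensions before existence and uniqueness of the root
  are established.\<close>

lemma mult_unit_vec_eq_col:
  fixes A :: "real mat"
  assumes A: "A \<in> carrier_mat m n" and j: "j < n"
  shows "A *\<^sub>v unit_vec n j = col A j"
  by (rule eq_vecI) (use A j in \<open>auto simp: scalar_prod_right_unit\<close>)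

lemma mat_eq_by_vecI:
  fixes A B :: "real mat"
  assumes A: "A \<in> carrier_mat m n" and B: "B \<in> carrier_mat m n"
    and eq: "\<And>x. x \<in> carrier_vec n \<Longrightarrow> A *\<^sub>v x = B *\<^sub>v x"
  shows "A = B"
proof (rule mat_col_eqI)
  fix j assume j: "j < dim_col B"
  have "A *\<^sub>v unit_vec n j = B *\<^sub>v unit_vec n j" by (rule eq) simp
  then show "col A j = col B j"
    using mult_unit_vec_eq_col[OF A] mult_unit_vec_eq_col[OF B] B j by simp
qed (use A B in auto)

lemma adjoint_scalar_prod:
  fixes M :: "real mat"
  assumes "M \<in> carrier_mat m n" "x \<in> carrier_vec m" "y \<in> carrier_vec n"
  shows "x \<bullet> (M *\<^sub>v y) = (transpose_mat M *\<^sub>v x) \<bullet> y"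
  using transpose_vec_mult_scalar[OF assms(1) assms(3) assms(2)] by simp

lemma symmetric_scalar_prod:
  fixes M :: "real mat"
  assumes "M \<in> carrier_mat n n" "transpose_mat M = M" "x \<in> carrier_vec n" "y \<in> carrier_vec n"
  shows "x \<bullet> (M *\<^sub>v y) = (M *\<^sub>v x) \<bullet> y"
  using adjoint_scalar_prod[of M n n x y] assms by simp

lemma scalar_prod_self_nonneg: "0 \<le> (v :: real vec) \<bullet> v"
  by (auto simp: scalar_prod_def intro: sum_nonneg)

lemma scalar_prod_self_eq_0_iff:
  fixes v :: "real vec"
  assumes "v \<in> carrier_vec n"
  shows "v \<bullet> v = 0 \<longleftrightarrow> v = 0\<^sub>v n"
proof
  assume "v \<bullet> v = 0"
  then have "\<forall>i\<in>{0..<dim_vec v}. v $ i * v $ i = 0"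
    unfolding scalar_prod_def by (subst (asm) sum_nonneg_eq_0_iff) auto
  then show "v = 0\<^sub>v n" using assms by (intro eq_vecI) auto
qed (use assms in simp)

lemma scalar_prod_self_pos:
  fixes v :: "real vec"
  assumes "v \<in> carrier_vec n" "v \<noteq> 0\<^sub>v n"
  shows "0 < v \<bullet> v"
  using scalar_prod_self_eq_0_iff[OF assms(1)] scalar_prod_self_nonneg[of v] assms(2) by linarith

lemma vnorm_square: "vnorm v ^ 2 = v \<bullet> v"
  unfolding vnorm_def using scalar_prod_self_nonneg by simp

text \<open>A complex eigenvalue a + ib with eigenvector x + iy always exists. Comparing x . (A y)
  with (A x) . y gives b (|x|^2 + |y|^2) = 0, so b = 0, and whichever of x, y is nonzero is a real
  eigenvector.\<close>

lemma symmetric_real_eigenvector: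
  fixes A :: "real mat"
  assumes A: "A \<in> carrier_mat n n" and sym: "transpose_mat A = A" and n: "n > 0"
  obtains v e where "v \<in> carrier_vec n" "v \<bullet> v = 1" "A *\<^sub>v v = e \<cdot>\<^sub>v v"
proof -
  let ?C = "map_mat complex_of_real A"
  have C: "?C \<in> carrier_mat n n" using A by simp
  from spectrum_non_empty[OF C n] obtain l where "eigenvalue ?C l"
    unfolding spectrum_def by auto
  then obtain z where z: "z \<in> carrier_vec n" "z \<noteq> 0\<^sub>v n" "?C *\<^sub>v z = l \<cdot>\<^sub>v z"
    unfolding eigenvalue_def eigenvector_def using C by auto
  define x y where "x = map_vec Re z" and "y = map_vec Im z"
  define a b where "a = Re l" and "b = Im l"
  have x: "x \<in> carrier_vec n" and y: "y \<in> carrier_vec n"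
    using z by (auto simp: x_def y_def)
  have Cz: "(\<Sum>j<n. complex_of_real (A $$ (i,j)) * z $ j) = l * z $ i" if i: "i < n" for i
  proof -
    have "(\<Sum>j<n. complex_of_real (A $$ (i,j)) * z $ j) = (?C *\<^sub>v z) $ i"
      using i z(1) A by (simp add: mult_mat_vec_def scalar_prod_def atLeast0LessThan)
    also have "\<dots> = l * z $ i" unfolding z(3) using i z(1) by simp
    finally show ?thesis .
  qed
  have Ax: "A *\<^sub>v x = a \<cdot>\<^sub>v x - b \<cdot>\<^sub>v y"
  proof (rule eq_vecI)
    fix i assume "i < dim_vec (a \<cdot>\<^sub>v x - b \<cdot>\<^sub>v y)"
    then have i: "i < n" using y by simp
    show "(A *\<^sub>v x) $ i = (a \<cdot>\<^sub>v x - b \<cdot>\<^sub>v y) $ i"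
      using arg_cong[OF Cz[OF i], of Re] i A z
      by (simp add: scalar_prod_def atLeast0LessThan x_def y_def a_def b_def)
  qed (use A y in auto)
  have Ay: "A *\<^sub>v y = b \<cdot>\<^sub>v x + a \<cdot>\<^sub>v y"
  proof (rule eq_vecI)
    fix i assume "i < dim_vec (b \<cdot>\<^sub>v x + a \<cdot>\<^sub>v y)"
    then have i: "i < n" using y by simp
    show "(A *\<^sub>v y) $ i = (b \<cdot>\<^sub>v x + a \<cdot>\<^sub>v y) $ i"
      using arg_cong[OF Cz[OF i], of Im] i A z
      by (simp add: scalar_prod_def atLeast0LessThan x_def y_def a_def b_def)
  qed (use A y in auto)
  have "x \<bullet> (A *\<^sub>v y) = (A *\<^sub>v x) \<bullet> y"
    by (rule symmetric_scalar_prod[OF A sym x y])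
  then have "b * (x \<bullet> x + y \<bullet> y) = 0"
    unfolding Ax Ay using x y
    by (simp add: scalar_prod_add_distrib[of _ n] minus_scalar_prod_distrib[of _ n] algebra_simps)
  moreover have xy: "x \<noteq> 0\<^sub>v n \<or> y \<noteq> 0\<^sub>v n"
  proof (rule ccontr)
    assume "\<not> ?thesis"
    then have "\<And>i. i < n \<Longrightarrow> x $ i = 0 \<and> y $ i = 0" by auto
    then have "z = 0\<^sub>v n" using z(1)
      by (intro eq_vecI) (auto simp: x_def y_def complex_eq_iff)
    then show False using z(2) by simp
  qed
  ultimately have b: "b = 0"
    using scalar_prod_self_pos[OF x] scalar_prod_self_pos[OF y]
      scalar_prod_self_nonneg[of x] scalar_prod_self_nonneg[of y]
    by (auto simp: add_pos_nonneg add_nonneg_pos)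
  have "A *\<^sub>v x = a \<cdot>\<^sub>v x" "A *\<^sub>v y = a \<cdot>\<^sub>v y"
    unfolding Ax Ay b using x y by auto
  then obtain u where u: "u \<in> carrier_vec n" "u \<noteq> 0\<^sub>v n" "A *\<^sub>v u = a \<cdot>\<^sub>v u"
    using xy x y by blast
  define s where "s = 1 / sqrt (u \<bullet> u)"
  have "s * s * (u \<bullet> u) = 1"
    using scalar_prod_self_pos[OF u(1,2)] by (simp add: s_def)
  then have "(s \<cdot>\<^sub>v u) \<bullet> (s \<cdot>\<^sub>v u) = 1" using u(1) by (simp add: mult.assoc)
  moreover have "A *\<^sub>v (s \<cdot>\<^sub>v u) = a \<cdot>\<^sub>v (s \<cdot>\<^sub>v u)"
    using u A by (simp add: mult_mat_vec smult_smult_assoc mult.commute)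
  ultimately show ?thesis using that[of "s \<cdot>\<^sub>v u" a] u(1) by simp
qed

text \<open>Reflection in the hyperplane orthogonal to v - e_0: since both vectors have length one,
  it exchanges them.\<close>

lemma householder_reflection:
  fixes v :: "real vec"
  assumes v: "v \<in> carrier_vec n" "v \<bullet> v = 1" and n: "n > 0"
  obtains H where "H \<in> carrier_mat n n" "transpose_mat H = H" "H * H = 1\<^sub>m n"
    "H *\<^sub>v unit_vec n 0 = v"
proof -
  let ?e = "unit_vec n 0 :: real vec"
  define u where "u = v - ?e"
  \<comment> \<open>If v is already e_0, then u = 0 and division by zero makes c = 0, so H
    degenerates to the identity; \<open>cuu\<close> below survives this case.\<close>
  define c where "c = 2 / (u \<bullet> u)"
  define H where "H = mat n n (\<lambda>(i,j). (if i = j then 1 else 0) - c * u $ i * u $ j)"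
  have u: "u \<in> carrier_vec n" using v by (simp add: u_def)
  have H: "H \<in> carrier_mat n n" by (simp add: H_def)
  have Hx: "H *\<^sub>v x = x - (c * (u \<bullet> x)) \<cdot>\<^sub>v u" if x: "x \<in> carrier_vec n" for x
  proof (rule eq_vecI)
    fix i assume "i < dim_vec (x - (c * (u \<bullet> x)) \<cdot>\<^sub>v u)"
    then have i: "i < n" using u by simp
    have "(H *\<^sub>v x) $ i = (\<Sum>j<n. ((if i = j then 1 else 0) - c * u $ i * u $ j) * x $ j)"
      using i x by (simp add: H_def scalar_prod_def atLeast0LessThan)
    also have "\<dots> = (\<Sum>j<n. (if i = j then x $ j else 0)) - c * u $ i * (\<Sum>j<n. u $ j * x $ j)"
      by (simp add: left_diff_distrib sum_subtractf sum_distrib_left mult.assoc if_distrib[of "\<lambda>t. t * _"] cong: if_cong)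
    also have "\<dots> = (x - (c * (u \<bullet> x)) \<cdot>\<^sub>v u) $ i"
      using i x u by (simp add: scalar_prod_def atLeast0LessThan)
    finally show "(H *\<^sub>v x) $ i = (x - (c * (u \<bullet> x)) \<cdot>\<^sub>v u) $ i" .
  qed (use u in \<open>auto simp: H_def\<close>)
  have cuu: "c * (c * (u \<bullet> u)) = 2 * c"
    by (simp add: c_def)
  have "H * H = 1\<^sub>m n"
  proof (rule mat_eq_by_vecI)
    fix x :: "real vec" assume x: "x \<in> carrier_vec n"
    have "H *\<^sub>v (H *\<^sub>v x) = x"
    proof (rule eq_vecI)
      fix i assume "i < dim_vec x"
      then have i: "i < n" using x by simp
      have "(H *\<^sub>v (H *\<^sub>v x)) $ i
        = x $ i - 2 * c * (u \<bullet> x) * u $ i + c * (c * (u \<bullet> u)) * (u \<bullet> x) * u $ i"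
        using x u i by (simp add: Hx scalar_prod_minus_distrib[of _ n] algebra_simps)
      then show "(H *\<^sub>v (H *\<^sub>v x)) $ i = x $ i" using cuu by simp
    qed (use x H in auto)
    then show "(H * H) *\<^sub>v x = 1\<^sub>m n *\<^sub>v x" using H x by simp
  qed (use H in auto)
  moreover have "H *\<^sub>v ?e = v"
  proof -
    have ue: "u \<bullet> ?e = v $ 0 - 1" using v(1) n
      by (simp add: u_def minus_scalar_prod_distrib[of _ n])
    have "u \<bullet> u = 2 - 2 * v $ 0" using v n
      by (simp add: u_def minus_scalar_prod_distrib[of _ n] scalar_prod_minus_distrib[of _ n])
    \<comment> \<open>This is where |v| = 1 matters: it makes the reflection subtract exactly -u
      from e_0.\<close>
    then have uu: "u \<bullet> u = - 2 * (u \<bullet> ?e)" using ue by simp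
    show ?thesis
    proof (cases "u \<bullet> u = 0")
      case True
      then have u0: "u = 0\<^sub>v n" using scalar_prod_self_eq_0_iff[OF u] by simp
      have "v = ?e"
      proof (rule eq_vecI)
        fix i assume "i < dim_vec ?e"
        then show "v $ i = ?e $ i" using arg_cong[OF u0, of "\<lambda>w. w $ i"] v(1) by (simp add: u_def)
      qed (use v in auto)
      moreover have "H *\<^sub>v ?e = ?e" using Hx[of ?e] u0 by (intro eq_vecI) auto
      ultimately show ?thesis by simp
    next
      case False
      then have "c * (u \<bullet> ?e) = - 1" using uu by (simp add: c_def)
      then have "H *\<^sub>v ?e = ?e - (- 1) \<cdot>\<^sub>v u" using Hx[of ?e] by simp
      also have "\<dots> = v" using v(1) by (auto simp: u_def)
      finally show ?thesis .
    qed
  qed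
  moreover have "transpose_mat H = H"
    by (rule eq_matI) (auto simp: H_def)
  ultimately show ?thesis using that[OF H] by blast
qed

definition real_orthogonal_mat :: "nat \<Rightarrow> real mat \<Rightarrow> bool" where
  "real_orthogonal_mat n U \<longleftrightarrow> U \<in> carrier_mat n n \<and> transpose_mat U * U = 1\<^sub>m n \<and> U * transpose_mat U = 1\<^sub>m n"

lemma real_orthogonal_mat_mult:
  assumes "real_orthogonal_mat n U" "real_orthogonal_mat n V"
  shows "real_orthogonal_mat n (U * V)"
proof -
  note c = assms[unfolded real_orthogonal_mat_def]
  have U: "U \<in> carrier_mat n n" "transpose_mat U \<in> carrier_mat n n"
    and V: "V \<in> carrier_mat n n" "transpose_mat V \<in> carrier_mat n n" using c by auto
  have "transpose_mat (U * V) * (U * V) = transpose_mat V * ((transpose_mat U * U) * V)"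
    using U V by (simp add: transpose_mult[of _ n n _ n] assoc_mult_mat[of _ n n _ n _ n])
  moreover have "U * V * transpose_mat (U * V) = U * ((V * transpose_mat V) * transpose_mat U)"
    using U V by (simp add: transpose_mult[of _ n n _ n] assoc_mult_mat[of _ n n _ n _ n])
  ultimately show ?thesis using c U V unfolding real_orthogonal_mat_def by simp
qed

lemma four_block_diag_mult:
  assumes "A \<in> carrier_mat a a" "B \<in> carrier_mat b b" "C \<in> carrier_mat a a" "D \<in> carrier_mat b b"
  shows "four_block_mat A (0\<^sub>m a b) (0\<^sub>m b a) B * four_block_mat C (0\<^sub>m a b) (0\<^sub>m b a) D
     = four_block_mat (A * C) (0\<^sub>m a b) (0\<^sub>m b a) ((B::real mat) * D)"
  using assms by (subst mult_four_block_mat[of _ a a _ b _ b _ _ a _ b]) auto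

lemma conjugation_assoc:
  fixes H V D W :: "real mat"
  assumes "H \<in> carrier_mat n n" "V \<in> carrier_mat n n" "D \<in> carrier_mat n n" "W \<in> carrier_mat n n"
  shows "H * (V * D * W) * H = (H * V) * D * (W * H)"
  using assms by (simp add: assoc_mult_mat[of _ n n _ n _ n] mult_carrier_mat[of _ n n _ n] del: assoc_mult_mat)

text \<open>Deflation by induction on the size. Conjugating with the reflection that sends e_0 to a
  unit eigenvector leaves the eigenvalue alone in the first column; symmetry clears the first row as
  well, and the remaining block is symmetric and one size smaller.\<close>

theorem symmetric_orthogonal_diagonalization:
  fixes A :: "real mat"
  assumes "A \<in> carrier_mat n n" "transpose_mat A = A"
  shows "\<exists>U d. real_orthogonal_mat n U \<and> A = U * mat_diag n d * transpose_mat U"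
  using assms
proof (induction n arbitrary: A)
  case 0
  then show ?case
    by (intro exI[of _ "0\<^sub>m 0 0"] exI[of _ "\<lambda>_. 0"]) (auto simp: real_orthogonal_mat_def)
next
  case (Suc n)
  note A = Suc.prems
  obtain v e where v: "v \<in> carrier_vec (Suc n)" "v \<bullet> v = 1" "A *\<^sub>v v = e \<cdot>\<^sub>v v"
    using symmetric_real_eigenvector[OF A] by auto
  obtain H where H: "H \<in> carrier_mat (Suc n) (Suc n)" "transpose_mat H = H" "H * H = 1\<^sub>m (Suc n)"
    and Hv: "H *\<^sub>v unit_vec (Suc n) 0 = v"
    using householder_reflection[OF v(1,2)] by auto
  have oH: "real_orthogonal_mat (Suc n) H" using H by (simp add: real_orthogonal_mat_def)
  define A' where "A' = H * A * H"
  have A': "A' \<in> carrier_mat (Suc n) (Suc n)" using H A by (simp add: A'_def)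
  have symA': "transpose_mat A' = A'" unfolding A'_def using H A
    by (simp add: transpose_mult[of _ "Suc n" "Suc n" _ "Suc n"] assoc_mult_mat[of _ "Suc n" "Suc n" _ "Suc n" _ "Suc n"])
  have Hv': "H *\<^sub>v v = unit_vec (Suc n) 0"
  proof -
    have "H *\<^sub>v v = (H * H) *\<^sub>v unit_vec (Suc n) 0" unfolding Hv[symmetric] using H(1) by simp
    then show ?thesis unfolding H(3) by simp
  qed
  have A'e: "A' *\<^sub>v unit_vec (Suc n) 0 = e \<cdot>\<^sub>v unit_vec (Suc n) 0"
  proof -
    have "A' *\<^sub>v unit_vec (Suc n) 0 = H *\<^sub>v (A *\<^sub>v (H *\<^sub>v unit_vec (Suc n) 0))"
      unfolding A'_def using H A by (simp add: assoc_mult_mat_vec[of _ "Suc n" "Suc n" _ "Suc n"])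
    also have "\<dots> = e \<cdot>\<^sub>v (H *\<^sub>v v)" unfolding Hv v(3) using H v by (simp add: mult_mat_vec)
    finally show ?thesis unfolding Hv' .
  qed
  have c0: "A' $$ (i, 0) = (if i = 0 then e else 0)" if "i < Suc n" for i
  proof -
    have "A' $$ (i,0) = (A' *\<^sub>v unit_vec (Suc n) 0) $ i"
      using A' that by (subst mult_unit_vec_eq_col[OF A']) auto
    also have "\<dots> = (if i = 0 then e else 0)" unfolding A'e using that by simp
    finally show ?thesis .
  qed
  have r0: "A' $$ (0, i) = (if i = 0 then e else 0)" if "i < Suc n" for i
  proof -
    have "A' $$ (0, i) = transpose_mat A' $$ (i, 0)" using A' that by simp
    also have "\<dots> = A' $$ (i, 0)" unfolding symA' ..
    finally show ?thesis using c0[OF that] by simp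
  qed
  define A3 where "A3 = mat n n (\<lambda>(i,j). A' $$ (Suc i, Suc j))"
  have A3: "A3 \<in> carrier_mat n n" by (simp add: A3_def)
  have "transpose_mat A3 = A3"
  proof (rule eq_matI)
    fix i j assume ij: "i < dim_row A3" "j < dim_col A3"
    have "A' $$ (Suc j, Suc i) = transpose_mat A' $$ (Suc i, Suc j)" using A' ij A3 by simp
    then have "A' $$ (Suc j, Suc i) = A' $$ (Suc i, Suc j)" unfolding symA' .
    then show "transpose_mat A3 $$ (i,j) = A3 $$ (i,j)" using ij by (simp add: A3_def)
  qed (auto simp: A3_def)
  from Suc.IH[OF A3 this] obtain U d where U: "real_orthogonal_mat n U"
    and A3eq: "A3 = U * mat_diag n d * transpose_mat U" by blast
  have Uc: "U \<in> carrier_mat n n" using U by (simp add: real_orthogonal_mat_def)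
  let ?e = "mat_diag 1 (\<lambda>_. e)"
  have A'block: "A' = four_block_mat ?e (0\<^sub>m 1 n) (0\<^sub>m n 1) A3"
    by (rule eq_matI) (use A' c0 r0 in \<open>auto simp: A3_def mat_diag_def\<close>)
  define V where "V = four_block_mat (1\<^sub>m 1) (0\<^sub>m 1 n) (0\<^sub>m n 1) U"
  have Vt: "transpose_mat V = four_block_mat (1\<^sub>m 1) (0\<^sub>m 1 n) (0\<^sub>m n 1) (transpose_mat U)"
    unfolding V_def using Uc by (subst transpose_four_block_mat[of _ 1 1 _ n _ n]) auto
  have one: "four_block_mat (1\<^sub>m 1) (0\<^sub>m 1 n) (0\<^sub>m n 1) (1\<^sub>m n) = (1\<^sub>m (Suc n) :: real mat)"
    by (rule eq_matI) auto
  have oV: "real_orthogonal_mat (Suc n) V"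
  proof -
    have "transpose_mat V * V = 1\<^sub>m (Suc n)" "V * transpose_mat V = 1\<^sub>m (Suc n)"
      unfolding Vt unfolding V_def
      by (subst four_block_diag_mult, use Uc U one in \<open>auto simp: real_orthogonal_mat_def\<close>)+
    moreover have "V \<in> carrier_mat (Suc n) (Suc n)" using Uc by (auto simp: V_def)
    ultimately show ?thesis by (simp add: real_orthogonal_mat_def)
  qed
  have Vc: "V \<in> carrier_mat (Suc n) (Suc n)" using oV by (simp add: real_orthogonal_mat_def)
  let ?d = "\<lambda>i. if i = 0 then e else d (i - 1)"
  have D: "mat_diag (Suc n) ?d = four_block_mat ?e (0\<^sub>m 1 n) (0\<^sub>m n 1) (mat_diag n d)"
    by (rule eq_matI) (auto simp: mat_diag_def)
  have Dc: "mat_diag (Suc n) ?d \<in> carrier_mat (Suc n) (Suc n)" by simp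
  have e1: "?e \<in> carrier_mat 1 1" by (rule mat_diag_dim)
  have e2: "1\<^sub>m 1 * ?e = ?e" "?e * 1\<^sub>m 1 = ?e"
    by (rule left_mult_one_mat[OF e1], rule right_mult_one_mat[OF e1])
  have UDc: "U * mat_diag n d \<in> carrier_mat n n" by (rule mult_carrier_mat[OF Uc mat_diag_dim])
  have Utc: "transpose_mat U \<in> carrier_mat n n" using Uc by simp
  have "V * mat_diag (Suc n) ?d * transpose_mat V = A'"
    unfolding Vt unfolding V_def D A'block A3eq
    using four_block_diag_mult[OF one_carrier_mat[of 1] Uc e1 mat_diag_dim[of n d]]
      four_block_diag_mult[OF e1 UDc one_carrier_mat[of 1] Utc] e2 by simp
  moreover have "A = H * A' * H"
  proof -
    have "H * A' * H = (H * H) * A * (H * H)" unfolding A'_def using H(1) A(1)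
      by (simp add: assoc_mult_mat[of _ "Suc n" "Suc n" _ "Suc n" _ "Suc n"])
    then show ?thesis using H A by simp
  qed
  ultimately have "A = H * (V * mat_diag (Suc n) ?d * transpose_mat V) * H" by simp
  also have "\<dots> = (H * V) * mat_diag (Suc n) ?d * transpose_mat (H * V)"
    using conjugation_assoc[OF H(1) Vc Dc, of "transpose_mat V"] Vc
      transpose_mult[OF H(1) Vc] H(2) by simp
  finally show ?case using real_orthogonal_mat_mult[OF oH oV] by blast
qed

section \<open>Quadratic forms in diagonalizing coordinates\<close>

lemma mult3_mat_vec:
  assumes "A \<in> carrier_mat n n" "B \<in> carrier_mat n n" "C \<in> carrier_mat n n" "x \<in> carrier_vec n"
  shows "(A * B * C) *\<^sub>v x = A *\<^sub>v (B *\<^sub>v (C *\<^sub>v (x :: real vec)))"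
  using assoc_mult_mat_vec[OF mult_carrier_mat[OF assms(1,2)] assms(3,4)]
    assoc_mult_mat_vec[OF assms(1,2) mult_mat_vec_carrier[OF assms(3,4)]] by (rule trans)

lemma mult3_mat_square:
  fixes U D V :: "real mat"
  assumes "U \<in> carrier_mat n n" "D \<in> carrier_mat n n" "V \<in> carrier_mat n n" "V * U = 1\<^sub>m n"
  shows "(U * D * V) * (U * D * V) = U * (D * D) * V"
proof -
  have UD: "U * D \<in> carrier_mat n n" using assms(1,2) by (rule mult_carrier_mat)
  have "(U * D * V) * (U * D * V) = (U * D) * (V * (U * D * V))"
    by (rule assoc_mult_mat[OF UD assms(3) mult_carrier_mat[OF UD assms(3)]])
  also have "V * (U * D * V) = V * (U * (D * V))"
    using assms(1-3) by (subst assoc_mult_mat[of U n n D n V n]) auto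
  also have "\<dots> = (V * U) * (D * V)"
    by (rule assoc_mult_mat[OF assms(3,1) mult_carrier_mat[OF assms(2,3)], symmetric])
  also have "\<dots> = D * V" unfolding assms(4) by (rule left_mult_one_mat[OF mult_carrier_mat[OF assms(2,3)]])
  also have "(U * D) * (D * V) = U * D * D * V"
    by (rule assoc_mult_mat[OF UD assms(2,3), symmetric])
  also have "U * D * D = U * (D * D)" by (rule assoc_mult_mat[OF assms(1,2,2)])
  finally show ?thesis .
qed

lemma transpose_mult3:
  fixes A B C :: "real mat"
  assumes "A \<in> carrier_mat n n" "B \<in> carrier_mat n n" "C \<in> carrier_mat n n"
  shows "transpose_mat (A * B * C) = transpose_mat C * transpose_mat B * transpose_mat A"
  using assms by (simp add: transpose_mult[of _ n n _ n])

lemma scalar_prod_diag: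
  assumes "x \<in> carrier_vec n" "y \<in> carrier_vec n"
  shows "x \<bullet> (mat_diag n d *\<^sub>v y) = (\<Sum>i<n. d i * (x $ i * y $ i :: real))"
proof -
  have "(mat_diag n d *\<^sub>v y) $ i = d i * y $ i" if i: "i < n" for i
  proof -
    have "(mat_diag n d *\<^sub>v y) $ i = (\<Sum>j<n. (if i = j then d j else 0) * y $ j)"
      using i assms(2) by (simp add: mat_diag_def mult_mat_vec_def scalar_prod_def atLeast0LessThan)
    also have "\<dots> = (\<Sum>j<n. if i = j then d j * y $ j else 0)"
      by (intro sum.cong) auto
    finally show ?thesis using i by simp
  qed
  then show ?thesis using assms
    by (auto simp: scalar_prod_def atLeast0LessThan mat_diag_def intro!: sum.cong)
qed

lemma real_orthogonal_mat_scalar_prod: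
  assumes U: "real_orthogonal_mat n U" and "x \<in> carrier_vec n" "y \<in> carrier_vec n"
  shows "(U *\<^sub>v x) \<bullet> (U *\<^sub>v y) = x \<bullet> y"
    and "(transpose_mat U *\<^sub>v x) \<bullet> (transpose_mat U *\<^sub>v y) = x \<bullet> y"
proof -
  have Uc: "U \<in> carrier_mat n n" "transpose_mat U \<in> carrier_mat n n"
    and UtU: "transpose_mat U * U = 1\<^sub>m n" and UUt: "U * transpose_mat U = 1\<^sub>m n"
    using U by (auto simp: real_orthogonal_mat_def)
  have "x \<bullet> (transpose_mat U *\<^sub>v (U *\<^sub>v y)) = x \<bullet> ((transpose_mat U * U) *\<^sub>v y)"
    using Uc assms by simp
  then show "(U *\<^sub>v x) \<bullet> (U *\<^sub>v y) = x \<bullet> y"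
    unfolding UtU using adjoint_scalar_prod[of "transpose_mat U" n n x "U *\<^sub>v y"] Uc assms by simp
  have "x \<bullet> (U *\<^sub>v (transpose_mat U *\<^sub>v y)) = x \<bullet> ((U * transpose_mat U) *\<^sub>v y)"
    using Uc assms by simp
  then show "(transpose_mat U *\<^sub>v x) \<bullet> (transpose_mat U *\<^sub>v y) = x \<bullet> y"
    unfolding UUt using adjoint_scalar_prod[of U n n x "transpose_mat U *\<^sub>v y"] Uc assms by simp
qed

lemma diagonalized_quadratic_form:
  assumes U: "real_orthogonal_mat n U" and x: "x \<in> carrier_vec n"
  shows "x \<bullet> ((U * mat_diag n d * transpose_mat U) *\<^sub>v x)
    = (\<Sum>i<n. d i * ((transpose_mat U *\<^sub>v x) $ i)\<^sup>2)"
proof -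
  have Uc: "U \<in> carrier_mat n n" "transpose_mat U \<in> carrier_mat n n"
    using U by (auto simp: real_orthogonal_mat_def)
  have D: "mat_diag n d \<in> carrier_mat n n" by simp
  let ?w = "transpose_mat U *\<^sub>v x"
  have w: "?w \<in> carrier_vec n" using Uc x by simp
  have "(U * mat_diag n d * transpose_mat U) *\<^sub>v x = U *\<^sub>v (mat_diag n d *\<^sub>v ?w)"
    by (rule mult3_mat_vec[OF Uc(1) D Uc(2) x])
  then have "x \<bullet> ((U * mat_diag n d * transpose_mat U) *\<^sub>v x) = ?w \<bullet> (mat_diag n d *\<^sub>v ?w)"
    using adjoint_scalar_prod[OF Uc(1) x, of "mat_diag n d *\<^sub>v ?w"] D w by simp
  then show ?thesis by (simp add: scalar_prod_diag[OF w w] power2_eq_square)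
qed

lemma diagonalized_eigenvector:
  assumes U: "real_orthogonal_mat n U" and i: "i < n"
  defines "u \<equiv> U *\<^sub>v unit_vec n i"
  shows "(U * mat_diag n d * transpose_mat U) *\<^sub>v u = d i \<cdot>\<^sub>v u" and "u \<in> carrier_vec n" and "u \<bullet> u = 1"
proof -
  have Uc: "U \<in> carrier_mat n n" "transpose_mat U \<in> carrier_mat n n"
    and UtU: "transpose_mat U * U = 1\<^sub>m n"
    using U by (auto simp: real_orthogonal_mat_def)
  have D: "mat_diag n d \<in> carrier_mat n n" by simp
  show u: "u \<in> carrier_vec n" using Uc by (simp add: u_def)
  have "transpose_mat U *\<^sub>v u = (transpose_mat U * U) *\<^sub>v unit_vec n i"
    using Uc by (simp add: u_def)
  then have Utu: "transpose_mat U *\<^sub>v u = unit_vec n i" unfolding UtU by simp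
  have De: "mat_diag n d *\<^sub>v unit_vec n i = d i \<cdot>\<^sub>v unit_vec n i"
    unfolding mult_unit_vec_eq_col[OF D i]
    by (rule eq_vecI) (use i in \<open>auto simp: mat_diag_def\<close>)
  have "(U * mat_diag n d * transpose_mat U) *\<^sub>v u = U *\<^sub>v (mat_diag n d *\<^sub>v (transpose_mat U *\<^sub>v u))"
    by (rule mult3_mat_vec[OF Uc(1) D Uc(2) u])
  then show "(U * mat_diag n d * transpose_mat U) *\<^sub>v u = d i \<cdot>\<^sub>v u"
    unfolding Utu De using Uc by (simp add: u_def mult_mat_vec)
  show "u \<bullet> u = 1"
    unfolding u_def using real_orthogonal_mat_scalar_prod(1)[OF U, of "unit_vec n i" "unit_vec n i"] i by simp
qed

lemma symmetric_quadratic_form_upper_bound: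
  fixes M :: "real mat"
  assumes M: "M \<in> carrier_mat n n" "transpose_mat M = M"
  obtains c where "c > 0" "\<And>x. x \<in> carrier_vec n \<Longrightarrow> x \<bullet> (M *\<^sub>v x) \<le> c * (x \<bullet> x)"
proof -
  obtain U d where U: "real_orthogonal_mat n U" and Meq: "M = U * mat_diag n d * transpose_mat U"
    using symmetric_orthogonal_diagonalization[OF M] by blast
  have Uc: "transpose_mat U \<in> carrier_mat n n" using U by (simp add: real_orthogonal_mat_def)
  \<comment> \<open>The sum dominates every eigenvalue, and the extra 1 keeps c positive when all of
    them vanish or n = 0.\<close>
  define c where "c = 1 + (\<Sum>i<n. \<bar>d i\<bar>)"
  have dc: "d i \<le> c" if "i < n" for i
    using member_le_sum[of i "{..<n}" "\<lambda>i. \<bar>d i\<bar>"] that by (simp add: c_def)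
  have "x \<bullet> (M *\<^sub>v x) \<le> c * (x \<bullet> x)" if x: "x \<in> carrier_vec n" for x
  proof -
    let ?w = "transpose_mat U *\<^sub>v x"
    have "x \<bullet> (M *\<^sub>v x) \<le> (\<Sum>i<n. c * (?w $ i)\<^sup>2)"
      unfolding Meq diagonalized_quadratic_form[OF U x]
      by (intro sum_mono mult_right_mono) (auto intro: dc)
    also have "\<dots> = c * (?w \<bullet> ?w)"
      using Uc by (simp add: scalar_prod_def sum_distrib_left power2_eq_square atLeast0LessThan)
    also have "?w \<bullet> ?w = x \<bullet> x" by (rule real_orthogonal_mat_scalar_prod(2)[OF U x x])
    finally show ?thesis .
  qed
  moreover have "c > 0" by (simp add: c_def add_pos_nonneg sum_nonneg)
  ultimately show ?thesis using that by blast
qed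

text \<open>A squared operator-norm bound, read off from the Gram matrix of M.\<close>

lemma mult_vec_scalar_prod_self_bound:
  fixes M :: "real mat"
  assumes M: "M \<in> carrier_mat m n"
  obtains c where "c > 0" "\<And>x. x \<in> carrier_vec n \<Longrightarrow> (M *\<^sub>v x) \<bullet> (M *\<^sub>v x) \<le> c * (x \<bullet> x)"
proof -
  have "transpose_mat M * M \<in> carrier_mat n n" "transpose_mat (transpose_mat M * M) = transpose_mat M * M"
    using M by (auto simp: transpose_mult[of _ n m _ n])
  then obtain c where c: "c > 0" "\<And>x. x \<in> carrier_vec n \<Longrightarrow> x \<bullet> ((transpose_mat M * M) *\<^sub>v x) \<le> c * (x \<bullet> x)"
    by (rule symmetric_quadratic_form_upper_bound) blast
  have "(M *\<^sub>v x) \<bullet> (M *\<^sub>v x) = x \<bullet> ((transpose_mat M * M) *\<^sub>v x)" if x: "x \<in> carrier_vec n" for x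
    using adjoint_scalar_prod[of "transpose_mat M" n m x "M *\<^sub>v x"] M x by simp
  then show ?thesis using that[of c] c by simp
qed

section \<open>Definite matrices: coercivity, square roots, inverses\<close>

lemma pdD:
  assumes "pd M" "M \<in> carrier_mat n n"
  shows "transpose_mat M = M" "\<And>v. v \<in> carrier_vec n \<Longrightarrow> v \<noteq> 0\<^sub>v n \<Longrightarrow> 0 < v \<bullet> (M *\<^sub>v v)"
  using assms by (auto simp: pd_def sym_mat_def)

lemma psdD:
  assumes "psd M" "M \<in> carrier_mat n n"
  shows "transpose_mat M = M" "\<And>v. v \<in> carrier_vec n \<Longrightarrow> 0 \<le> v \<bullet> (M *\<^sub>v v)"
  using assms by (auto simp: psd_def sym_mat_def)

lemma pd_carrier_mat:
  assumes "pd M" "dim_row M = n"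
  shows "M \<in> carrier_mat n n"
  using assms by (auto simp: pd_def sym_mat_def)

lemma psd_carrier_mat:
  assumes "psd M" "dim_row M = n"
  shows "M \<in> carrier_mat n n"
  using assms by (auto simp: psd_def sym_mat_def)

lemma pd_imp_psd:
  assumes "pd M"
  shows "psd M"
proof -
  define n where "n = dim_row M"
  have M: "M \<in> carrier_mat n n" unfolding n_def by (rule pd_carrier_mat[OF assms refl])
  have "0 \<le> v \<bullet> (M *\<^sub>v v)" if v: "v \<in> carrier_vec n" for v
    using pdD(2)[OF assms M v] M by (cases "v = 0\<^sub>v n") auto
  then show ?thesis using assms by (simp add: pd_def psd_def n_def)
qed

text \<open>The smallest eigenvalue serves as the constant. This is what converts the strict sign of
  an LMI into a margin proportional to |x|^2.\<close>

lemma pd_lower_bound: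
  assumes "pd M" and M: "M \<in> carrier_mat n n"
  obtains c where "c > 0" "\<And>x. x \<in> carrier_vec n \<Longrightarrow> c * (x \<bullet> x) \<le> x \<bullet> (M *\<^sub>v x)"
proof -
  note Md = pdD[OF assms]
  obtain U d where U: "real_orthogonal_mat n U" and Meq: "M = U * mat_diag n d * transpose_mat U"
    using symmetric_orthogonal_diagonalization[OF M Md(1)] by blast
  have Uc: "transpose_mat U \<in> carrier_mat n n" using U by (simp add: real_orthogonal_mat_def)
  have dpos: "d i > 0" if i: "i < n" for i
  proof -
    let ?u = "U *\<^sub>v unit_vec n i"
    note e = diagonalized_eigenvector(1)[OF U i, of d, folded Meq] diagonalized_eigenvector(2,3)[OF U i]
    have "?u \<noteq> 0\<^sub>v n" using e(3) by auto
    then have "0 < ?u \<bullet> (M *\<^sub>v ?u)" using Md(2) e(2) by blast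
    then show ?thesis using e by simp
  qed
  \<comment> \<open>The inserted 1 keeps the set nonempty for n = 0 and does no harm
    otherwise.\<close>
  define c where "c = Min (insert 1 (d ` {..<n}))"
  have c: "c > 0" using dpos by (auto simp: c_def)
  have cd: "c \<le> d i" if "i < n" for i using that by (auto simp: c_def intro: Min_le)
  have "c * (x \<bullet> x) \<le> x \<bullet> (M *\<^sub>v x)" if x: "x \<in> carrier_vec n" for x
  proof -
    let ?w = "transpose_mat U *\<^sub>v x"
    have "c * (x \<bullet> x) = c * (?w \<bullet> ?w)" by (simp add: real_orthogonal_mat_scalar_prod(2)[OF U x x])
    also have "\<dots> = (\<Sum>i<n. c * (?w $ i)\<^sup>2)"
      using Uc by (simp add: scalar_prod_def sum_distrib_left power2_eq_square atLeast0LessThan)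
    also have "\<dots> \<le> x \<bullet> (M *\<^sub>v x)"
      unfolding Meq diagonalized_quadratic_form[OF U x]
      by (intro sum_mono mult_right_mono) (auto intro: cd)
    finally show ?thesis .
  qed
  then show ?thesis using that c by blast
qed

lemma psd_sqrt_exists:
  assumes "psd M" and M: "M \<in> carrier_mat n n"
  shows "\<exists>S. psd S \<and> dim_row S = n \<and> S * S = M"
proof -
  note Md = psdD[OF assms]
  obtain U d where U: "real_orthogonal_mat n U" and Meq: "M = U * mat_diag n d * transpose_mat U"
    using symmetric_orthogonal_diagonalization[OF M Md(1)] by blast
  have Uc: "U \<in> carrier_mat n n" "transpose_mat U \<in> carrier_mat n n"
    and UtU: "transpose_mat U * U = 1\<^sub>m n"
    using U by (auto simp: real_orthogonal_mat_def)
  have dnn: "d i \<ge> 0" if i: "i < n" for i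
  proof -
    note e = diagonalized_eigenvector(1)[OF U i, of d, folded Meq] diagonalized_eigenvector(2,3)[OF U i]
    show ?thesis using Md(2)[OF e(2)] e by simp
  qed
  let ?D = "mat_diag n (\<lambda>i. sqrt (d i))"
  have D: "?D \<in> carrier_mat n n" by simp
  define S where "S = U * ?D * transpose_mat U"
  have S: "S \<in> carrier_mat n n" unfolding S_def by (intro mult_carrier_mat[OF mult_carrier_mat[OF Uc(1) D] Uc(2)])
  have Dt: "transpose_mat ?D = ?D" by (rule eq_matI) (auto simp: mat_diag_def)
  have "transpose_mat S = S"
    unfolding S_def transpose_mult3[OF Uc(1) D Uc(2)] Dt by simp
  moreover have "0 \<le> x \<bullet> (S *\<^sub>v x)" if x: "x \<in> carrier_vec n" for x
    unfolding S_def diagonalized_quadratic_form[OF U x] by (auto intro!: sum_nonneg mult_nonneg_nonneg dnn)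
  ultimately have "psd S" using S by (simp add: psd_def sym_mat_def)
  moreover have "S * S = M"
  proof -
    have "?D * ?D = mat_diag n d"
      unfolding mat_diag_diag by (rule eq_matI) (auto simp: mat_diag_def dnn)
    then show ?thesis
      unfolding S_def Meq mult3_mat_square[OF Uc(1) D Uc(2) UtU] by simp
  qed
  ultimately show ?thesis using S by auto
qed

text \<open>With \<open>E = S - T\<close> one has \<open>S E + E T = S\<^sup>2 - T\<^sup>2 = 0\<close>; pairing with a unit eigenvector of \<open>E\<close>
  kills its eigenvalue, so commutation of the two roots is never needed.\<close>

lemma psd_sqrt_unique:
  assumes S: "psd S" "S \<in> carrier_mat n n" and T: "psd T" "T \<in> carrier_mat n n"
    and eq: "S * S = T * T"
  shows "S = T"
proof -
  note Sd = psdD[OF S] and Td = psdD[OF T]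
  have "transpose_mat (S - T) = S - T"
    using Sd(1) Td(1) transpose_minus[OF S(2) T(2)] by simp
  moreover have "S - T \<in> carrier_mat n n" using T(2) by (rule minus_carrier_mat)
  ultimately obtain U d where U: "real_orthogonal_mat n U" and Eeq: "S - T = U * mat_diag n d * transpose_mat U"
    using symmetric_orthogonal_diagonalization by blast
  have "d i = 0" if i: "i < n" for i
  proof (rule ccontr)
    assume nz: "d i \<noteq> 0"
    let ?u = "U *\<^sub>v unit_vec n i"
    note e = diagonalized_eigenvector(1)[OF U i, of d, folded Eeq] diagonalized_eigenvector(2,3)[OF U i]
    have Ex: "(S - T) *\<^sub>v x = S *\<^sub>v x - T *\<^sub>v x" if "x \<in> carrier_vec n" for x
      using minus_mult_distrib_mat_vec[OF S(2) T(2) that] .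
    have SS: "S *\<^sub>v (S *\<^sub>v ?u) = T *\<^sub>v (T *\<^sub>v ?u)"
      using arg_cong[OF eq, of "\<lambda>M. M *\<^sub>v ?u"] S(2) T(2) e(2) by simp
    have Su: "S *\<^sub>v ?u \<in> carrier_vec n" and Tu: "T *\<^sub>v ?u \<in> carrier_vec n" using S T e(2) by auto
    have dS: "d i * (?u \<bullet> (S *\<^sub>v ?u)) = ?u \<bullet> (S *\<^sub>v (S *\<^sub>v ?u)) - ?u \<bullet> (S *\<^sub>v (T *\<^sub>v ?u))"
    proof -
      have "d i * (?u \<bullet> (S *\<^sub>v ?u)) = ?u \<bullet> (S *\<^sub>v (d i \<cdot>\<^sub>v ?u))"
        using S(2) e(2) Su by (simp add: mult_mat_vec)
      also have "\<dots> = ?u \<bullet> (S *\<^sub>v (S *\<^sub>v ?u - T *\<^sub>v ?u))" using e(1) Ex[OF e(2)] by simp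
      finally show ?thesis
        using mult_minus_distrib_mat_vec[OF S(2) Su Tu] scalar_prod_minus_distrib[OF e(2), of "S *\<^sub>v (S *\<^sub>v ?u)" "S *\<^sub>v (T *\<^sub>v ?u)"]
          S(2) Su Tu by simp
    qed
    have dT: "d i * (?u \<bullet> (T *\<^sub>v ?u)) = ?u \<bullet> (S *\<^sub>v (T *\<^sub>v ?u)) - ?u \<bullet> (T *\<^sub>v (T *\<^sub>v ?u))"
    proof -
      have "d i * (?u \<bullet> (T *\<^sub>v ?u)) = ((S - T) *\<^sub>v ?u) \<bullet> (T *\<^sub>v ?u)"
        unfolding e(1) using e(2) Tu by simp
      also have "\<dots> = (S *\<^sub>v ?u) \<bullet> (T *\<^sub>v ?u) - (T *\<^sub>v ?u) \<bullet> (T *\<^sub>v ?u)"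
        unfolding Ex[OF e(2)] by (rule minus_scalar_prod_distrib[OF Su Tu Tu])
      finally show ?thesis
        using symmetric_scalar_prod[OF S(2) Sd(1) e(2) Tu] symmetric_scalar_prod[OF T(2) Td(1) e(2) Tu] by simp
    qed
    have "d i * (?u \<bullet> (S *\<^sub>v ?u) + ?u \<bullet> (T *\<^sub>v ?u)) = 0"
      using dS dT SS by (simp add: distrib_left)
    then have "?u \<bullet> (S *\<^sub>v ?u) + ?u \<bullet> (T *\<^sub>v ?u) = 0" using nz by simp
    \<comment> \<open>Semidefiniteness splits the vanishing sum into two vanishing terms; the
      eigenvalue \<open>d i\<close> is their difference.\<close>
    then have z: "?u \<bullet> (S *\<^sub>v ?u) = 0" "?u \<bullet> (T *\<^sub>v ?u) = 0"
      using Sd(2)[OF e(2)] Td(2)[OF e(2)] by linarith+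
    have "d i = ?u \<bullet> (d i \<cdot>\<^sub>v ?u)" using e(2,3) by simp
    also have "\<dots> = ?u \<bullet> (S *\<^sub>v ?u - T *\<^sub>v ?u)" using e(1) Ex[OF e(2)] by simp
    also have "\<dots> = 0" using z scalar_prod_minus_distrib[OF e(2) Su Tu] by simp
    finally show False using nz by simp
  qed
  then have "mat_diag n d = 0\<^sub>m n n" by (intro eq_matI) (auto simp: mat_diag_def)
  moreover have "U \<in> carrier_mat n n" "transpose_mat U \<in> carrier_mat n n"
    using U by (auto simp: real_orthogonal_mat_def)
  ultimately have ST: "S - T = 0\<^sub>m n n" unfolding Eeq by simp
  show ?thesis
  proof (rule eq_matI)
    fix i j assume "i < dim_row T" "j < dim_col T"
    then show "S $$ (i,j) = T $$ (i,j)"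
      using arg_cong[OF ST, of "\<lambda>M. M $$ (i,j)"] S(2) T(2) by simp
  qed (use S T in auto)
qed

text \<open>\<open>W\<close> and the output matrix contain the same roots, so what must be known
  about them is their shape. A definite description reveals it only through unique
  existence.\<close>

lemma msqrt_carrier_mat:
  assumes M: "psd M" "M \<in> carrier_mat n n"
  shows "msqrt M \<in> carrier_mat n n"
proof -
  have "\<exists>!S. psd S \<and> dim_row S = dim_row M \<and> S * S = M"
    using psd_sqrt_exists[OF M] psd_sqrt_unique psd_carrier_mat M(2)
    by (metis carrier_matD(1))
  then have "psd (msqrt M) \<and> dim_row (msqrt M) = dim_row M \<and> msqrt M * msqrt M = M"
    unfolding msqrt_def by (rule theI')
  then show ?thesis using psd_carrier_mat M(2) by auto
qed

text \<open>For square matrices a right inverse is two-sided, so a single witness makes the choice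
  in \<open>minv\<close> meaningful.\<close>

lemma minv_inverse:
  fixes M :: "real mat"
  assumes M: "M \<in> carrier_mat n n" and B: "B \<in> carrier_mat n n" and MB: "M * B = 1\<^sub>m n"
  shows "minv M \<in> carrier_mat n n" "M * minv M = 1\<^sub>m n" "minv M * M = 1\<^sub>m n"
proof -
  have "\<exists>B. B \<in> carrier_mat (dim_row M) (dim_row M) \<and> inverts_mat M B \<and> inverts_mat B M"
    using M B MB mat_mult_left_right_inverse[OF M B MB] by (auto simp: inverts_mat_def)
  from someI_ex[OF this] show "minv M \<in> carrier_mat n n" "M * minv M = 1\<^sub>m n" "minv M * M = 1\<^sub>m n"
    unfolding minv_def[symmetric] using M by (auto simp: inverts_mat_def)
qed

text \<open>A kernel vector would annihilate the quadratic form, so M is invertible. Positivity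
  transfers by writing v = M a, which turns v . (M^-1 v) into a . (M a).\<close>

lemma pd_minv:
  assumes "pd M" and M: "M \<in> carrier_mat n n"
  shows "minv M \<in> carrier_mat n n" "M * minv M = 1\<^sub>m n" "minv M * M = 1\<^sub>m n" "pd (minv M)"
proof -
  note Md = pdD[OF assms]
  have "det M \<noteq> 0"
  proof
    assume "det M = 0"
    then obtain v where "v \<in> carrier_vec n" "v \<noteq> 0\<^sub>v n" "M *\<^sub>v v = 0\<^sub>v n"
      using det_0_iff_vec_prod_zero[OF M] by blast
    then show False using Md(2)[of v] by simp
  qed
  then obtain B where "B \<in> carrier_mat n n" "M * B = 1\<^sub>m n"
    using det_non_zero_imp_unit[OF M, of undefined] unfolding Units_def ring_mat_def by auto
  note inv = minv_inverse[OF M this]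
  then show "minv M \<in> carrier_mat n n" "M * minv M = 1\<^sub>m n" "minv M * M = 1\<^sub>m n" by auto
  have "transpose_mat (minv M) * M = 1\<^sub>m n"
    using arg_cong[OF inv(2), of transpose_mat] transpose_mult[OF M inv(1)] Md(1) by simp
  \<comment> \<open>Symmetry of the inverse B: bracketing the product of B^T, M and B in two ways
    yields B^T on one side and B on the other.\<close>
  then have "transpose_mat (minv M) * (M * minv M) = 1\<^sub>m n * minv M"
    using M inv(1) by (metis assoc_mult_mat transpose_carrier_mat)
  then have sym: "transpose_mat (minv M) = minv M"
    unfolding inv(2) using inv(1) by simp
  have "0 < v \<bullet> (minv M *\<^sub>v v)" if v: "v \<in> carrier_vec n" "v \<noteq> 0\<^sub>v n" for v
  proof -
    let ?a = "minv M *\<^sub>v v"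
    have a: "?a \<in> carrier_vec n" using inv(1) v by simp
    have Ma: "M *\<^sub>v ?a = v"
    proof -
      have "M *\<^sub>v ?a = (M * minv M) *\<^sub>v v" using M inv(1) v by simp
      then show ?thesis unfolding inv(2) using v by simp
    qed
    have "M *\<^sub>v 0\<^sub>v n = 0\<^sub>v n" using M by (intro eq_vecI) auto
    then have "?a \<noteq> 0\<^sub>v n" using Ma v(2) by metis
    then have "0 < ?a \<bullet> (M *\<^sub>v ?a)" using Md(2) a by blast
    then show ?thesis unfolding Ma using comm_scalar_prod[OF a v(1)] by simp
  qed
  then show "pd (minv M)" using sym inv(1) by (simp add: pd_def sym_mat_def)
qed

subsection \<open>Block matrices and Kronecker products\<close>

lemma append_vec_assoc: "(u @\<^sub>v v) @\<^sub>v w = u @\<^sub>v (v @\<^sub>v w)"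
  by (rule eq_vecI) auto

text \<open>The \<open>_dim\<close> variants take equations between dimensions as premises. These
  can be decided by evaluation for nested blocks, whereas carrier premises would require the
  intermediate dimensions to be supplied at every block.\<close>

lemma append_vec_add_dim:
  assumes "dim_vec u = dim_vec u'" "dim_vec v = dim_vec v'"
  shows "(u @\<^sub>v v) + (u' @\<^sub>v v') = (u + u') @\<^sub>v (v + v')"
  using assms by (intro eq_vecI) auto

lemma scalar_prod_append_dim:
  assumes "dim_vec u = dim_vec u'" "dim_vec v = dim_vec v'"
  shows "(u @\<^sub>v v) \<bullet> (u' @\<^sub>v v') = u \<bullet> u' + v \<bullet> v'"
  by (rule scalar_prod_append[OF carrier_vecI[OF refl] carrier_vecI[OF refl]
        carrier_vecI[OF assms(1)[symmetric]] carrier_vecI[OF assms(2)[symmetric]]])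

lemma zero_mat_mult_vec_dim:
  assumes "dim_vec x = c"
  shows "0\<^sub>m r c *\<^sub>v x = (0\<^sub>v r :: real vec)"
  using assms by (intro eq_vecI) (auto simp: scalar_prod_def)

lemma one_mat_mult_vec_dim:
  assumes "dim_vec x = n"
  shows "1\<^sub>m n *\<^sub>v x = (x :: real vec)"
  using assms by (intro one_mult_mat_vec carrier_vecI)

lemma smult_one_mat_mult_vec_dim:
  assumes "dim_vec x = n"
  shows "(c \<cdot>\<^sub>m 1\<^sub>m n) *\<^sub>v x = c \<cdot>\<^sub>v (x :: real vec)"
proof (rule eq_vecI)
  fix i assume "i < dim_vec (c \<cdot>\<^sub>v x)"
  then have i: "i < n" using assms by simp
  have "row (c \<cdot>\<^sub>m 1\<^sub>m n) i = c \<cdot>\<^sub>v unit_vec n i"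
    using i by (intro eq_vecI) auto
  then show "((c \<cdot>\<^sub>m 1\<^sub>m n) *\<^sub>v x) $ i = (c \<cdot>\<^sub>v x) $ i"
    using i scalar_prod_left_unit[OF carrier_vecI[OF assms] i] assms by simp
qed (use assms in auto)

lemma add_zero_vec_dim:
  assumes "dim_vec x = n"
  shows "x + 0\<^sub>v n = (x :: real vec)" "0\<^sub>v n + x = x"
  using assms by (auto intro!: eq_vecI)

lemma scalar_prod_add_right_dim:
  assumes "dim_vec x = dim_vec y" "dim_vec y = dim_vec z"
  shows "x \<bullet> (y + z) = x \<bullet> y + x \<bullet> (z :: real vec)"
  by (rule scalar_prod_add_distrib[OF carrier_vecI[OF assms(1)] carrier_vecI[OF refl]
        carrier_vecI[OF assms(2)[symmetric]]])

lemma adjoint_scalar_prod_dim: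
  fixes M :: "real mat"
  assumes "dim_row M = dim_vec x" "dim_col M = dim_vec y"
  shows "y \<bullet> (transpose_mat M *\<^sub>v x) = x \<bullet> (M *\<^sub>v y)"
proof -
  have M: "M \<in> carrier_mat (dim_vec x) (dim_vec y)" by (rule carrier_matI[OF assms])
  have x: "x \<in> carrier_vec (dim_vec x)" by (rule carrier_vecI[OF refl])
  have y: "y \<in> carrier_vec (dim_vec y)" by (rule carrier_vecI[OF refl])
  have Mtx: "transpose_mat M *\<^sub>v x \<in> carrier_vec (dim_vec y)"
    by (rule carrier_vecI) (simp add: assms)
  show ?thesis
    by (rule trans[OF comm_scalar_prod[OF y Mtx] adjoint_scalar_prod[OF M x y, symmetric]])
qed

lemma hcat_dim [simp]: "dim_row (hcat A B) = dim_row A" "dim_col (hcat A B) = dim_col A + dim_col B"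
  by (auto simp: hcat_def)

lemma vcat_dim [simp]: "dim_row (vcat A B) = dim_row A + dim_row B" "dim_col (vcat A B) = dim_col A"
  by (auto simp: vcat_def)

lemma kron_dim [simp]: "dim_row (kron A B) = dim_row A * dim_row B" "dim_col (kron A B) = dim_col A * dim_col B"
  by (auto simp: kron_def)

lemma kron_vec_dim [simp]: "dim_vec (kron_vec v w) = dim_vec v * dim_vec w"
  by (auto simp: kron_vec_def)

lemma ones_dim [simp]: "dim_row (ones n) = n" "dim_col (ones n) = 1"
  by (auto simp: ones_def)

lemma colmat_dim [simp]: "dim_row (colmat v) = dim_vec v" "dim_col (colmat v) = 1"
  by (auto simp: colmat_def)

lemma hcat_mult_append:
  assumes "dim_col A = dim_vec u" "dim_col B = dim_vec w" "dim_row A = dim_row B"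
  shows "hcat A B *\<^sub>v (u @\<^sub>v w) = A *\<^sub>v u + B *\<^sub>v w"
proof (rule eq_vecI)
  fix i assume "i < dim_vec (A *\<^sub>v u + B *\<^sub>v w)"
  then have i: "i < dim_row A" using assms by simp
  have "row (hcat A B) i = row A i @\<^sub>v row B i"
    using i assms by (intro eq_vecI) (auto simp: hcat_def)
  then show "(hcat A B *\<^sub>v (u @\<^sub>v w)) $ i = (A *\<^sub>v u + B *\<^sub>v w) $ i"
    using i assms by (simp add: scalar_prod_append_dim)
qed (use assms in auto)

lemma vcat_mult_vec:
  assumes "dim_col A = dim_col B"
  shows "vcat A B *\<^sub>v x = (A *\<^sub>v x) @\<^sub>v (B *\<^sub>v x)"
proof (rule eq_vecI)
  fix i assume "i < dim_vec ((A *\<^sub>v x) @\<^sub>v (B *\<^sub>v x))"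
  then have i: "i < dim_row A + dim_row B" by simp
  have "row (vcat A B) i = (if i < dim_row A then row A i else row B (i - dim_row A))"
    using i assms by (intro eq_vecI) (auto simp: vcat_def)
  then show "(vcat A B *\<^sub>v x) $ i = ((A *\<^sub>v x) @\<^sub>v (B *\<^sub>v x)) $ i"
    using i by auto
qed auto

text \<open>The map j \<mapsto> (j div n, j mod n) enumerates all index pairs, so the sum
  factorizes. This is the index arithmetic behind the Kronecker product rules below.\<close>

lemma sum_div_mod_product:
  fixes f g :: "nat \<Rightarrow> real"
  shows "(\<Sum>j<m * n. f (j div n) * g (j mod n)) = (\<Sum>j<m. f j) * (\<Sum>j<n. g j)"
proof -
  have "(\<Sum>j<m * n. f (j div n) * g (j mod n)) = (\<Sum>i<m. \<Sum>j = i * n..<i * n + n. f (j div n) * g (j mod n))"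
    by (rule sum.nat_group[symmetric])
  also have "\<dots> = (\<Sum>i<m. \<Sum>j<n. f i * g j)"
  proof (rule sum.cong[OF refl])
    fix i
    have "(\<Sum>j = i * n..<i * n + n. f (j div n) * g (j mod n)) = (\<Sum>j<n. f ((i * n + j) div n) * g ((i * n + j) mod n))"
      using sum.shift_bounds_nat_ivl[of "\<lambda>j. f (j div n) * g (j mod n)" 0 "i * n" n]
      by (simp add: atLeast0LessThan add.commute)
    also have "\<dots> = (\<Sum>j<n. f i * g j)" by (intro sum.cong) auto
    finally show "(\<Sum>j = i * n..<i * n + n. f (j div n) * g (j mod n)) = (\<Sum>j<n. f i * g j)" .
  qed
  finally show ?thesis by (simp add: sum_product)
qed

lemma less_mult_imp_div_mod_less:
  assumes "i < m * (n::nat)"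
  shows "i div n < m" "i mod n < n"
proof -
  show "i div n < m" using assms by (simp add: less_mult_imp_div_less)
  have "n > 0" using assms by (cases n) auto
  then show "i mod n < n" by simp
qed

text \<open>The mixed-product rule on pure tensors. It covers the products with lifted vectors
  below, since these are built from p \<otimes> a, p \<otimes> p \<otimes> a and 1 \<otimes>
  [a; b].\<close>

lemma kron_mult_kron_vec:
  assumes "dim_col A = dim_vec a" "dim_col B = dim_vec b"
  shows "kron A B *\<^sub>v kron_vec a b = kron_vec (A *\<^sub>v a) (B *\<^sub>v b)"
proof (rule eq_vecI)
  fix i assume "i < dim_vec (kron_vec (A *\<^sub>v a) (B *\<^sub>v b))"
  then have i: "i < dim_row A * dim_row B" by simp
  let ?n = "dim_vec b"
  let ?f = "\<lambda>k. A $$ (i div dim_row B, k) * a $ k" and ?g = "\<lambda>k. B $$ (i mod dim_row B, k) * b $ k"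
  note im = less_mult_imp_div_mod_less[OF i]
  have "(kron A B *\<^sub>v kron_vec a b) $ i = (\<Sum>j<dim_vec a * ?n. ?f (j div ?n) * ?g (j mod ?n))"
    using i assms
    by (auto simp: kron_def kron_vec_def scalar_prod_def atLeast0LessThan intro!: sum.cong)
  also have "\<dots> = (\<Sum>j<dim_vec a. ?f j) * (\<Sum>j<?n. ?g j)"
    by (rule sum_div_mod_product)
  also have "\<dots> = kron_vec (A *\<^sub>v a) (B *\<^sub>v b) $ i"
    using i im assms by (simp add: kron_vec_def scalar_prod_def atLeast0LessThan)
  finally show "(kron A B *\<^sub>v kron_vec a b) $ i = kron_vec (A *\<^sub>v a) (B *\<^sub>v b) $ i" .
qed simp

lemma transpose_kron: "transpose_mat (kron A B) = kron (transpose_mat A) (transpose_mat B)"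
proof (rule eq_matI)
  fix i j assume "i < dim_row (kron (transpose_mat A) (transpose_mat B))"
    "j < dim_col (kron (transpose_mat A) (transpose_mat B))"
  then have i: "i < dim_col A * dim_col B" and j: "j < dim_row A * dim_row B" by auto
  show "transpose_mat (kron A B) $$ (i,j) = kron (transpose_mat A) (transpose_mat B) $$ (i,j)"
    using i j less_mult_imp_div_mod_less[OF i] less_mult_imp_div_mod_less[OF j] by (simp add: kron_def)
qed auto

lemma kron_vec_assoc: "kron_vec (kron_vec u v) w = kron_vec u (kron_vec v w)"
proof (rule eq_vecI)
  fix i assume "i < dim_vec (kron_vec u (kron_vec v w))"
  then have i: "i < dim_vec u * (dim_vec v * dim_vec w)" by simp
  let ?n = "dim_vec w" and ?m = "dim_vec v"
  have 1: "i div ?n < dim_vec u * ?m" using i by (intro less_mult_imp_div_mod_less) (simp add: mult.assoc)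
  have 2: "i mod (?m * ?n) < ?m * ?n" using i by (intro less_mult_imp_div_mod_less)
  \<comment> \<open>An index of a triple product has three digits in a mixed radix; the next three
    facts say that both bracketings extract the same digits.\<close>
  have 3: "i div ?n div ?m = i div (?m * ?n)" by (metis div_mult2_eq mult.commute)
  have 4: "i div ?n mod ?m = i mod (?m * ?n) div ?n"
  proof (cases "?n = 0")
    case False
    have "i mod (?m * ?n) = ?n * (i div ?n mod ?m) + i mod ?n"
      by (simp add: mod_mult2_eq mult.commute[of ?m])
    then show ?thesis using False by simp
  qed simp
  have 5: "i mod ?n = i mod (?m * ?n) mod ?n" by (rule mod_mod_cancel[symmetric]) simp
  have "kron_vec (kron_vec u v) w $ i = u $ (i div ?n div ?m) * v $ (i div ?n mod ?m) * w $ (i mod ?n)"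
    using i 1 by (subst kron_vec_def, subst index_vec) (simp_all add: kron_vec_def mult.assoc)
  moreover have "kron_vec u (kron_vec v w) $ i
      = u $ (i div (?m * ?n)) * (v $ (i mod (?m * ?n) div ?n) * w $ (i mod (?m * ?n) mod ?n))"
    using i 2 by (subst kron_vec_def, subst index_vec) (simp_all add: kron_vec_def)
  ultimately show "kron_vec (kron_vec u v) w $ i = kron_vec u (kron_vec v w) $ i"
    unfolding 3 4 5[symmetric] by simp
qed (simp add: mult.assoc)

lemma kron_vec_add_right:
  assumes "dim_vec v = dim_vec w"
  shows "kron_vec p (v + w) = kron_vec p v + kron_vec p w"
proof (rule eq_vecI)
  fix i assume "i < dim_vec (kron_vec p v + kron_vec p w)"
  then have i: "i < dim_vec p * dim_vec w" using assms by simp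
  show "kron_vec p (v + w) $ i = (kron_vec p v + kron_vec p w) $ i"
    using i less_mult_imp_div_mod_less[OF i] assms by (simp add: kron_vec_def distrib_left)
qed (use assms in auto)

text \<open>Writing x as 1 \<otimes> x makes the mixed-product rule applicable to Kronecker products
  whose left factor is a single column, such as \<open>colmat p\<close> and
  \<open>ones n\<close>.\<close>

lemma kron_vec_one_left: "kron_vec (vec (Suc 0) (\<lambda>_. 1)) v = v"
  by (rule eq_vecI) (auto simp: kron_vec_def)

lemma ones_mult_vec: "ones n *\<^sub>v vec (Suc 0) (\<lambda>_. 1) = vec n (\<lambda>_. 1)"
  by (rule eq_vecI) (auto simp: ones_def scalar_prod_def)

lemma colmat_mult_vec: "colmat p *\<^sub>v vec (Suc 0) (\<lambda>_. 1) = p"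
  by (rule eq_vecI) (auto simp: colmat_def mat_of_cols_def scalar_prod_def)

text \<open>This is how \<Delta>(p) turns 1 \<otimes> [a; b] into p \<otimes> [a; b].\<close>

lemma mat_diag_mult_ones:
  assumes "p \<in> carrier_vec n"
  shows "mat_diag n (\<lambda>i. p $ i) *\<^sub>v vec n (\<lambda>_. 1) = (p :: real vec)"
proof (rule eq_vecI)
  fix i assume "i < dim_vec p"
  then have i: "i < n" using assms by simp
  have "(mat_diag n (\<lambda>i. p $ i) *\<^sub>v vec n (\<lambda>_. 1)) $ i = (\<Sum>j<n. if i = j then p $ j else 0)"
    using i by (simp add: mat_diag_def scalar_prod_def atLeast0LessThan cong: if_cong)
  then show "(mat_diag n (\<lambda>i. p $ i) *\<^sub>v vec n (\<lambda>_. 1)) $ i = p $ i" using i by simp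
qed (use assms in \<open>auto simp: mat_diag_def\<close>)

lemma kron_colmat_mult_vec:
  assumes "dim_vec x = n"
  shows "kron (colmat p) (1\<^sub>m n) *\<^sub>v x = kron_vec p x"
  using kron_mult_kron_vec[of "colmat p" "vec (Suc 0) (\<lambda>_. 1)" "1\<^sub>m n" x] assms
  by (simp add: kron_vec_one_left colmat_mult_vec one_mat_mult_vec_dim)

lemma kron_ones_mult_vec:
  assumes "dim_col B = dim_vec x"
  shows "kron (ones n) B *\<^sub>v x = kron_vec (vec n (\<lambda>_. 1)) (B *\<^sub>v x)"
  using kron_mult_kron_vec[of "ones n" "vec (Suc 0) (\<lambda>_. 1)" B x] assms
  by (simp add: kron_vec_one_left ones_mult_vec)

lemma kron_one_mult_kron_vec:
  assumes "dim_vec p = n" "dim_col B = dim_vec x"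
  shows "kron (1\<^sub>m n) B *\<^sub>v kron_vec p x = kron_vec p (B *\<^sub>v x)"
  using kron_mult_kron_vec[of "1\<^sub>m n" p B x] assms by (simp add: one_mat_mult_vec_dim)

lemma kron_colmat_colmat_mult_vec:
  assumes "dim_vec x = n"
  shows "kron (kron (colmat p) (colmat p)) (1\<^sub>m n) *\<^sub>v x = kron_vec p (kron_vec p x)"
proof -
  let ?e = "vec (Suc 0) (\<lambda>_. 1) :: real vec"
  have "kron (colmat p) (colmat p) *\<^sub>v ?e = kron_vec p p"
    using kron_mult_kron_vec[of "colmat p" ?e "colmat p" ?e]
    by (simp add: kron_vec_one_left colmat_mult_vec)
  then show ?thesis
    using kron_mult_kron_vec[of "kron (colmat p) (colmat p)" ?e "1\<^sub>m n" x] assms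
    by (simp add: kron_vec_one_left one_mat_mult_vec_dim kron_vec_assoc)
qed

section \<open>Congruences, and the inverse of I \<otimes> P\<close>

lemma congruence_quadratic_form:
  fixes X M :: "real mat"
  assumes "X \<in> carrier_mat n n" "M \<in> carrier_mat n k" "x \<in> carrier_vec k"
  shows "x \<bullet> ((transpose_mat M * X * M) *\<^sub>v x) = (M *\<^sub>v x) \<bullet> (X *\<^sub>v (M *\<^sub>v x))"
proof -
  have Mt: "transpose_mat M \<in> carrier_mat k n" using assms(2) by simp
  have Mx: "M *\<^sub>v x \<in> carrier_vec n" using assms by simp
  have "(transpose_mat M * X * M) *\<^sub>v x = (transpose_mat M * X) *\<^sub>v (M *\<^sub>v x)"
    by (rule assoc_mult_mat_vec[OF mult_carrier_mat[OF Mt assms(1)] assms(2,3)])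
  also have "\<dots> = transpose_mat M *\<^sub>v (X *\<^sub>v (M *\<^sub>v x))"
    by (rule assoc_mult_mat_vec[OF Mt assms(1) Mx])
  finally show ?thesis
    using adjoint_scalar_prod[OF Mt assms(3), of "X *\<^sub>v (M *\<^sub>v x)"] assms(1) Mx by simp
qed

lemma kron_one_mult:
  assumes "dim_row C = dim_col B"
  shows "kron (1\<^sub>m n) B * kron (1\<^sub>m n) C = kron (1\<^sub>m n) (B * C)"
proof (rule eq_matI)
  fix i j assume "i < dim_row (kron (1\<^sub>m n) (B * C))" "j < dim_col (kron (1\<^sub>m n) (B * C))"
  then have i: "i < n * dim_row B" and j: "j < n * dim_col C" by auto
  note im = less_mult_imp_div_mod_less[OF i] and jm = less_mult_imp_div_mod_less[OF j]
  let ?i = "i div dim_row B" and ?j = "j div dim_col C"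
  \<comment> \<open>Each summand separates into Kronecker deltas in the block number of k and
    entries of B and C in its offset, the shape required by
    \<open>sum_div_mod_product\<close>.\<close>
  have e1: "k < n * dim_col B \<Longrightarrow> (kron (1\<^sub>m n) B $$ (i, k)) * (kron (1\<^sub>m n) C $$ (k, j))
      = ((if ?i = k div dim_col B then 1 else 0) * (if k div dim_col B = ?j then 1 else 0))
       * (B $$ (i mod dim_row B, k mod dim_col B) * C $$ (k mod dim_col B, j mod dim_col C))" for k
    using i j im jm less_mult_imp_div_mod_less[of k n "dim_col B"] assms by (simp add: kron_def)
  have "(kron (1\<^sub>m n) B * kron (1\<^sub>m n) C) $$ (i, j)
     = (\<Sum>k<n * dim_col B. (kron (1\<^sub>m n) B $$ (i, k)) * (kron (1\<^sub>m n) C $$ (k, j)))"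
    using i j assms by (simp add: scalar_prod_def atLeast0LessThan)
  also have "\<dots> = (\<Sum>k<n * dim_col B.
       ((if ?i = k div dim_col B then 1 else 0) * (if k div dim_col B = ?j then 1 else 0))
       * (B $$ (i mod dim_row B, k mod dim_col B) * C $$ (k mod dim_col B, j mod dim_col C)))"
    by (intro sum.cong) (auto simp: e1)
  also have "\<dots> = (\<Sum>k<n. (if ?i = k then 1 else 0) * (if k = ?j then 1 else 0))
       * (\<Sum>k<dim_col B. B $$ (i mod dim_row B, k) * C $$ (k, j mod dim_col C))"
    by (rule sum_div_mod_product)
  also have "(\<Sum>k<n. (if ?i = k then 1 else 0) * (if k = ?j then 1 else 0 :: real)) = (if ?i = ?j then 1 else 0)"
    using im(1) by (subst sum.remove[of _ ?i]) (auto intro!: sum.neutral)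
  finally show "(kron (1\<^sub>m n) B * kron (1\<^sub>m n) C) $$ (i, j) = kron (1\<^sub>m n) (B * C) $$ (i, j)"
    using i j im jm assms by (auto simp: kron_def scalar_prod_def atLeast0LessThan)
qed simp_all

lemma kron_one_one: "kron (1\<^sub>m n) (1\<^sub>m k) = 1\<^sub>m (n * k)"
proof (rule eq_matI)
  fix i j assume "i < dim_row (1\<^sub>m (n * k) :: real mat)" "j < dim_col (1\<^sub>m (n * k) :: real mat)"
  then have i: "i < n * k" and j: "j < n * k" by auto
  have "i = j \<longleftrightarrow> i div k = j div k \<and> i mod k = j mod k"
    by (metis div_mult_mod_eq)
  then show "kron (1\<^sub>m n) (1\<^sub>m k) $$ (i, j) = 1\<^sub>m (n * k) $$ (i, j)"
    using i j less_mult_imp_div_mod_less[OF i] less_mult_imp_div_mod_less[OF j] by (simp add: kron_def)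
qed simp_all

text \<open>The matrix I \<otimes> P^-1 witnesses invertibility; afterwards only the left-inverse
  property of the chosen inverse is used.\<close>

lemma minv_kron_one:
  assumes "pd P" and P: "P \<in> carrier_mat n n"
  shows "minv (kron (1\<^sub>m k) P) \<in> carrier_mat (k * n) (k * n)"
    and "minv (kron (1\<^sub>m k) P) * kron (1\<^sub>m k) P = 1\<^sub>m (k * n)"
proof -
  note inv = pd_minv[OF assms]
  have inv_kron: "kron (1\<^sub>m k) P * kron (1\<^sub>m k) (minv P) = 1\<^sub>m (k * n)"
    using P inv(1,2) by (simp add: kron_one_mult kron_one_one)
  have "kron (1\<^sub>m k) P \<in> carrier_mat (k * n) (k * n)" "kron (1\<^sub>m k) (minv P) \<in> carrier_mat (k * n) (k * n)"
    by (rule carrier_matI; use P inv(1) in simp)+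
  note minv_inverse[OF this inv_kron]
  then show "minv (kron (1\<^sub>m k) P) \<in> carrier_mat (k * n) (k * n)"
    "minv (kron (1\<^sub>m k) P) * kron (1\<^sub>m k) P = 1\<^sub>m (k * n)"
    by auto
qed

text \<open>The block row [M_1 ... M_np], which multiplies p \<otimes> x. Blocks are counted from 0
  but coefficients from 1, hence the \<open>Suc\<close>.\<close>

definition coeff_stack :: "(nat \<Rightarrow> real mat) \<Rightarrow> nat \<Rightarrow> real mat" where
  "coeff_stack M np = mat (dim_row (M 0)) (np * dim_col (M 0))
     (\<lambda>(i,j). M (Suc (j div dim_col (M 0))) $$ (i, j mod dim_col (M 0)))"

lemma coeff_stack_dim [simp]:
  "dim_row (coeff_stack M np) = dim_row (M 0)" "dim_col (coeff_stack M np) = np * dim_col (M 0)"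
  by (auto simp: coeff_stack_def)

lemma aff_dim [simp]: "dim_row (aff M np p) = dim_row (M 0)" "dim_col (aff M np p) = dim_col (M 0)"
  by (auto simp: aff_def)

lemma aff_mult_vec:
  assumes p: "p \<in> carrier_vec np" and x: "x \<in> carrier_vec (dim_col (M 0))"
  shows "aff M np p *\<^sub>v x = M 0 *\<^sub>v x + coeff_stack M np *\<^sub>v kron_vec p x"
proof (rule eq_vecI)
  let ?n = "dim_col (M 0)"
  fix i assume "i < dim_vec (M 0 *\<^sub>v x + coeff_stack M np *\<^sub>v kron_vec p x)"
  then have i: "i < dim_row (M 0)" by simp
  have "(coeff_stack M np *\<^sub>v kron_vec p x) $ i
     = (\<Sum>j<np * ?n. M (Suc (j div ?n)) $$ (i, j mod ?n) * (p $ (j div ?n) * x $ (j mod ?n)))"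
    using i p x by (auto simp: coeff_stack_def kron_vec_def scalar_prod_def atLeast0LessThan intro!: sum.cong)
  also have "\<dots> = (\<Sum>l<np. \<Sum>j = l * ?n..<l * ?n + ?n. M (Suc (j div ?n)) $$ (i, j mod ?n) * (p $ (j div ?n) * x $ (j mod ?n)))"
    by (rule sum.nat_group[symmetric])
  also have "\<dots> = (\<Sum>l<np. \<Sum>j<?n. M (Suc l) $$ (i, j) * (p $ l * x $ j))"
  proof (rule sum.cong[OF refl])
    fix l
    let ?h = "\<lambda>j. M (Suc (j div ?n)) $$ (i, j mod ?n) * (p $ (j div ?n) * x $ (j mod ?n))"
    have "(\<Sum>j = l * ?n..<l * ?n + ?n. ?h j) = (\<Sum>j<?n. ?h (l * ?n + j))"
      using sum.shift_bounds_nat_ivl[of ?h 0 "l * ?n" ?n] by (simp add: atLeast0LessThan add.commute)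
    also have "\<dots> = (\<Sum>j<?n. M (Suc l) $$ (i, j) * (p $ l * x $ j))" by (intro sum.cong) auto
    finally show "(\<Sum>j = l * ?n..<l * ?n + ?n. ?h j) = (\<Sum>j<?n. M (Suc l) $$ (i, j) * (p $ l * x $ j))" .
  qed
  also have "\<dots> = (\<Sum>j<?n. \<Sum>l<np. M (Suc l) $$ (i, j) * (p $ l * x $ j))"
    by (rule sum.swap)
  also have "\<dots> = (\<Sum>j<?n. (\<Sum>l = 1..np. p $ (l - 1) * M l $$ (i, j)) * x $ j)"
    by (simp add: sum.atLeast1_atMost_eq sum_distrib_left sum_distrib_right mult_ac)
  finally have c: "(coeff_stack M np *\<^sub>v kron_vec p x) $ i = \<dots>" .
  show "(aff M np p *\<^sub>v x) $ i = (M 0 *\<^sub>v x + coeff_stack M np *\<^sub>v kron_vec p x) $ i"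
    using i x p c by (simp add: aff_def scalar_prod_def atLeast0LessThan distrib_right sum.distrib)
qed (use assms in auto)

text \<open>Each off-diagonal block occurs together with its transpose and so contributes twice.
  Having \<open>W\<close> as a polynomial in the five components allows optimal components to be
  substituted instead of taking Schur complements.\<close>

lemma performance_quadratic_form:
  fixes P G H J E :: "real mat" and \<gamma> :: real
  assumes "P \<in> carrier_mat m m" "G \<in> carrier_mat m m" "H \<in> carrier_mat h m" "J \<in> carrier_mat j m" "E \<in> carrier_mat k m"
    and "a \<in> carrier_vec m" "b \<in> carrier_vec m" "c \<in> carrier_vec h" "d \<in> carrier_vec j" "e \<in> carrier_vec k"
  defines "s \<equiv> a @\<^sub>v b @\<^sub>v c @\<^sub>v d @\<^sub>v e"
  defines "W \<equiv> blockmat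
     [[P, transpose_mat G, transpose_mat H, transpose_mat J, 0\<^sub>m m k],
      [G, P, 0\<^sub>m m h, 0\<^sub>m m j, transpose_mat E],
      [H, 0\<^sub>m h m, \<gamma> \<cdot>\<^sub>m 1\<^sub>m h, 0\<^sub>m h j, 0\<^sub>m h k],
      [J, 0\<^sub>m j m, 0\<^sub>m j h, \<gamma> \<cdot>\<^sub>m 1\<^sub>m j, 0\<^sub>m j k],
      [0\<^sub>m k m, E, 0\<^sub>m k h, 0\<^sub>m k j, \<gamma> \<cdot>\<^sub>m 1\<^sub>m k]]"
  shows "s \<bullet> (W *\<^sub>v s) = a \<bullet> (P *\<^sub>v a) + 2 * (b \<bullet> (G *\<^sub>v a)) + b \<bullet> (P *\<^sub>v b)
    + 2 * (c \<bullet> (H *\<^sub>v a)) + \<gamma> * (c \<bullet> c) + 2 * (d \<bullet> (J *\<^sub>v a)) + \<gamma> * (d \<bullet> d)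
    + 2 * (e \<bullet> (E *\<^sub>v b)) + \<gamma> * (e \<bullet> e)"
proof -
  note dims = assms(1-5)[THEN carrier_matD(1)] assms(1-5)[THEN carrier_matD(2)] assms(6-10)[THEN carrier_vecD]
  show ?thesis
    unfolding s_def W_def blockmat_def
    by (simp add: dims vcat_mult_vec hcat_mult_append zero_mat_mult_vec_dim smult_one_mat_mult_vec_dim
        add_zero_vec_dim scalar_prod_append_dim scalar_prod_add_right_dim adjoint_scalar_prod_dim)
qed

subsection \<open>Strictly dissipative parameter-varying systems\<close>

lemma traj_carrier:
  assumes "\<And>p. p \<in> PP \<Longrightarrow> Acl p \<in> carrier_mat n n" "\<And>k. ps k \<in> PP" "\<And>k. w k \<in> carrier_vec n"
    and "x0 \<in> carrier_vec n"
  shows "traj Acl ps w x0 k \<in> carrier_vec n"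
proof (induction k)
  case (Suc k)
  then show ?case using mult_mat_vec_carrier[OF assms(1)[OF assms(2)] Suc.IH] assms(3) by simp
qed (use assms in simp)

lemma exponential_decay_imp_stabilizing:
  assumes C: "C > 0" and r: "0 \<le> r" "r < 1"
    and decay: "\<And>ps x0 k. (\<forall>k. ps k \<in> PP) \<Longrightarrow> x0 \<in> carrier_vec n \<Longrightarrow>
      vnorm (traj Acl ps (\<lambda>_. 0\<^sub>v n) x0 k) \<le> C * r ^ k * vnorm x0"
  shows "stabilizing n PP Acl"
  unfolding stabilizing_def
proof (intro allI impI conjI)
  fix ps :: "nat \<Rightarrow> real vec" and e :: real
  assume ps: "\<forall>k. ps k \<in> PP" and e: "e > 0"
  \<comment> \<open>Since r^k \<le> 1, the state never exceeds C times its initial norm, so the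
    radius e / C works.\<close>
  show "\<exists>\<delta>>0. \<forall>x0\<in>carrier_vec n. vnorm x0 < \<delta> \<longrightarrow> (\<forall>k. vnorm (traj Acl ps (\<lambda>_. 0\<^sub>v n) x0 k) < e)"
  proof (intro exI[of _ "e / C"] conjI ballI impI allI)
    fix x0 :: "real vec" and k
    assume x0: "x0 \<in> carrier_vec n" "vnorm x0 < e / C"
    have "0 \<le> vnorm x0" by (simp add: vnorm_def scalar_prod_self_nonneg)
    then have "C * r ^ k * vnorm x0 \<le> C * 1 * vnorm x0"
      using C r by (intro mult_right_mono mult_left_mono power_le_one) auto
    also have "\<dots> < e" using x0(2) C by (simp add: pos_less_divide_eq mult.commute)
    finally show "vnorm (traj Acl ps (\<lambda>_. 0\<^sub>v n) x0 k) < e"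
      using decay[OF ps x0(1), of k] by linarith
  qed (use e C in simp)
next
  fix ps :: "nat \<Rightarrow> real vec"
  assume ps: "\<forall>k. ps k \<in> PP"
  \<comment> \<open>Attraction is global; the radius 1 is arbitrary.\<close>
  show "\<exists>\<delta>>0. \<forall>x0\<in>carrier_vec n. vnorm x0 < \<delta> \<longrightarrow> (\<lambda>k. vnorm (traj Acl ps (\<lambda>_. 0\<^sub>v n) x0 k)) \<longlonglongrightarrow> 0"
  proof (intro exI[of _ "1 :: real"] conjI ballI impI)
    fix x0 :: "real vec" assume x0: "x0 \<in> carrier_vec n"
    have "(\<lambda>k. C * r ^ k * vnorm x0) \<longlonglongrightarrow> C * 0 * vnorm x0"
      using r by (intro tendsto_intros LIMSEQ_realpow_zero)
    then have lim: "(\<lambda>k. C * r ^ k * vnorm x0) \<longlonglongrightarrow> 0" by simp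
    show "(\<lambda>k. vnorm (traj Acl ps (\<lambda>_. 0\<^sub>v n) x0 k)) \<longlonglongrightarrow> 0"
      by (rule tendsto_sandwich[OF _ _ tendsto_const lim])
        (use decay[OF ps x0] in \<open>auto simp: vnorm_def scalar_prod_self_nonneg\<close>)
  qed simp
qed

text \<open>The two margins have separate roles: \<delta> drives the decay of the undisturbed state,
  \<epsilon> makes the gain strictly smaller than \<gamma>. All constants are uniform over
  \<open>PP\<close>, so arbitrary scheduling sequences are covered.\<close>

locale strictly_dissipative =
  fixes n :: nat and PP :: "real vec set" and Acl Cz :: "real vec \<Rightarrow> real mat"
    and V :: "real vec \<Rightarrow> real" and c1 c2 \<gamma> \<epsilon> \<delta> :: real
  assumes pos: "c1 > 0" "c2 > 0" "\<gamma> > 0" "\<epsilon> > 0" "\<delta> > 0"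
    and V_lower: "\<And>x. x \<in> carrier_vec n \<Longrightarrow> c1 * (x \<bullet> x) \<le> V x"
    and V_upper: "\<And>x. x \<in> carrier_vec n \<Longrightarrow> V x \<le> c2 * (x \<bullet> x)"
    and Acl: "\<And>p. p \<in> PP \<Longrightarrow> Acl p \<in> carrier_mat n n"
    and dissipation: "\<And>p x w. p \<in> PP \<Longrightarrow> x \<in> carrier_vec n \<Longrightarrow> w \<in> carrier_vec n \<Longrightarrow>
      V (Acl p *\<^sub>v x + w) + ((Cz p *\<^sub>v x) \<bullet> (Cz p *\<^sub>v x)) / \<gamma>
        \<le> V x + (\<gamma> - \<epsilon>) * (w \<bullet> w) - \<delta> * (x \<bullet> x)"
begin

lemma V_nonneg: "x \<in> carrier_vec n \<Longrightarrow> 0 \<le> V x"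
  using V_lower[of x] pos(1) scalar_prod_self_nonneg[of x] mult_nonneg_nonneg[of c1 "x \<bullet> x"] by linarith

text \<open>The bounds V(x+) \<le> V(x) - \<delta> |x|^2 and V(x) \<le> c2 |x|^2 suggest the factor
  1 - \<delta>/c2, whose sign depends on the constants. The slightly larger c2 / (c2 + \<delta>)
  always lies strictly between 0 and 1.\<close>

lemma V_contraction:
  assumes p: "p \<in> PP" and x: "x \<in> carrier_vec n"
  shows "V (Acl p *\<^sub>v x + 0\<^sub>v n) \<le> c2 / (c2 + \<delta>) * V x"
proof -
  let ?z = "(Cz p *\<^sub>v x) \<bullet> (Cz p *\<^sub>v x)"
  have "0 \<le> ?z / \<gamma>" using scalar_prod_self_nonneg pos(3) by simp
  then have "V (Acl p *\<^sub>v x + 0\<^sub>v n) \<le> V x - \<delta> * (x \<bullet> x)"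
    using dissipation[OF p x, of "0\<^sub>v n"] by simp
  then have "(c2 + \<delta>) * V (Acl p *\<^sub>v x + 0\<^sub>v n) \<le> (c2 + \<delta>) * (V x - \<delta> * (x \<bullet> x))"
    using pos by (intro mult_left_mono) auto
  moreover have "\<delta> * V x \<le> \<delta> * (c2 * (x \<bullet> x))"
    using V_upper[OF x] pos by simp
  moreover have "0 \<le> \<delta> * (\<delta> * (x \<bullet> x))"
    using pos scalar_prod_self_nonneg[of x] by simp
  ultimately have "(c2 + \<delta>) * V (Acl p *\<^sub>v x + 0\<^sub>v n) \<le> c2 * V x"
    by (simp add: algebra_simps)
  then show ?thesis using pos by (simp add: field_simps)
qed

lemma stabilizing: "stabilizing n PP Acl"
proof (rule exponential_decay_imp_stabilizing)
  let ?\<rho> = "c2 / (c2 + \<delta>)"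
  have \<rho>: "0 \<le> ?\<rho>" "?\<rho> < 1" using pos by auto
  show "0 \<le> sqrt ?\<rho>" "sqrt ?\<rho> < 1" "sqrt (c2 / c1) > 0" using \<rho> pos by auto
  fix ps :: "nat \<Rightarrow> real vec" and x0 :: "real vec" and k
  assume ps: "\<forall>k. ps k \<in> PP" and x0: "x0 \<in> carrier_vec n"
  let ?x = "traj Acl ps (\<lambda>_. 0\<^sub>v n) x0"
  have x: "?x k \<in> carrier_vec n" for k
    by (rule traj_carrier[of PP]) (use Acl ps x0 in auto)
  have "V (?x k) \<le> ?\<rho> ^ k * V x0" for k
  proof (induction k)
    case (Suc k)
    have "V (?x (Suc k)) \<le> ?\<rho> * V (?x k)"
      using V_contraction[OF _ x[of k], of "ps k"] ps by simp
    also have "\<dots> \<le> ?\<rho> * (?\<rho> ^ k * V x0)" by (intro mult_left_mono Suc.IH \<rho>)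
    finally show ?case by (simp add: mult.assoc)
  qed simp
  then have "c1 * (?x k \<bullet> ?x k) \<le> ?\<rho> ^ k * (c2 * (x0 \<bullet> x0))"
    using V_lower[OF x[of k]] mult_left_mono[OF V_upper[OF x0], of "?\<rho> ^ k"] \<rho>
    by (meson order_trans zero_le_power)
  then have "?x k \<bullet> ?x k \<le> (c2 / c1) * ?\<rho> ^ k * (x0 \<bullet> x0)"
    using pos by (simp add: field_simps)
  then have "vnorm (?x k) \<le> sqrt ((c2 / c1) * ?\<rho> ^ k * (x0 \<bullet> x0))"
    unfolding vnorm_def by (rule real_sqrt_le_mono)
  then show "vnorm (?x k) \<le> sqrt (c2 / c1) * sqrt ?\<rho> ^ k * vnorm x0"
    by (simp only: vnorm_def real_sqrt_mult real_sqrt_power)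
qed

lemma l2_gain_less: "l2_gain n PP Acl Cz < ereal \<gamma>"
proof -
  \<comment> \<open>Capping the margin at \<gamma>/2 keeps \<gamma> - e positive. This makes the
    bound g positive and allows the partial energy of w to be replaced by the whole series.\<close>
  define e where "e = min \<epsilon> (\<gamma> / 2)"
  have e: "0 < e" "e \<le> \<epsilon>" "e < \<gamma>" using pos by (auto simp: e_def min_def)
  define g where "g = sqrt (\<gamma> * (\<gamma> - e))"
  have g0: "g > 0" using e pos by (simp add: g_def)
  have "\<gamma> * (\<gamma> - e) < \<gamma> * \<gamma>" using e pos by simp
  then have g\<gamma>: "g < \<gamma>"
    unfolding g_def using pos real_sqrt_less_mono[of "\<gamma> * (\<gamma> - e)" "\<gamma> * \<gamma>"] by simp
  have "l2_gain_bound n PP Acl Cz g"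
    unfolding l2_gain_bound_def
  proof (intro allI impI)
    fix ps w :: "nat \<Rightarrow> real vec" and N
    assume ps: "\<forall>k. ps k \<in> PP" and w: "\<forall>k. w k \<in> carrier_vec n" and sw: "summable (\<lambda>k. vnorm (w k) ^ 2)"
    let ?x = "traj Acl ps w (0\<^sub>v n)"
    let ?z = "\<lambda>k. Cz (ps k) *\<^sub>v ?x k"
    have x: "?x k \<in> carrier_vec n" for k
      by (rule traj_carrier[of PP]) (use Acl ps w in auto)
    have "V (?x N) + (\<Sum>k<N. ?z k \<bullet> ?z k) / \<gamma> \<le> (\<gamma> - e) * (\<Sum>k<N. w k \<bullet> w k)"
    proof (induction N)
      case 0
      \<comment> \<open>The zero initial state enters here: the upper bound on V at the origin
        leaves no initial storage.\<close>
      then show ?case using V_upper[of "0\<^sub>v n"] by simp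
    next
      case (Suc N)
      have "V (?x (Suc N)) + (?z N \<bullet> ?z N) / \<gamma> \<le> V (?x N) + (\<gamma> - \<epsilon>) * (w N \<bullet> w N) - \<delta> * (?x N \<bullet> ?x N)"
        using dissipation[OF _ x[of N], of "ps N" "w N"] ps w by simp
      also have "\<dots> \<le> V (?x N) + (\<gamma> - e) * (w N \<bullet> w N)"
        using mult_right_mono[of "\<gamma> - \<epsilon>" "\<gamma> - e" "w N \<bullet> w N"] e(2) scalar_prod_self_nonneg[of "w N"]
          scalar_prod_self_nonneg[of "?x N"] mult_nonneg_nonneg[of \<delta> "?x N \<bullet> ?x N"] pos by linarith
      finally show ?case using Suc.IH
        by (simp add: add_divide_distrib distrib_left del: traj.simps)
    qed
    then have "(\<Sum>k<N. ?z k \<bullet> ?z k) / \<gamma> \<le> (\<gamma> - e) * (\<Sum>k<N. w k \<bullet> w k)"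
      using V_nonneg[OF x[of N]] by linarith
    then have "(\<Sum>k<N. ?z k \<bullet> ?z k) \<le> \<gamma> * (\<gamma> - e) * (\<Sum>k<N. w k \<bullet> w k)"
      using pos by (simp add: field_simps)
    also have "(\<Sum>k<N. w k \<bullet> w k) \<le> (\<Sum>k. vnorm (w k) ^ 2)"
      using sum_le_suminf[OF sw, of "{..<N}"] by (simp add: vnorm_square scalar_prod_self_nonneg)
    then have "\<gamma> * (\<gamma> - e) * (\<Sum>k<N. w k \<bullet> w k) \<le> \<gamma> * (\<gamma> - e) * (\<Sum>k. vnorm (w k) ^ 2)"
      using e pos by (intro mult_left_mono) auto
    finally have "sqrt (\<Sum>k<N. ?z k \<bullet> ?z k) \<le> sqrt (\<gamma> * (\<gamma> - e) * (\<Sum>k. vnorm (w k) ^ 2))"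
      by (rule real_sqrt_le_mono)
    then show "sqrt (\<Sum>k<N. vnorm (?z k) ^ 2) \<le> g * sqrt (\<Sum>k. vnorm (w k) ^ 2)"
      by (simp only: vnorm_square g_def real_sqrt_mult)
  qed
  \<comment> \<open>The gain is an infimum, so a single admissible g below \<gamma> gives the strict
    inequality.\<close>
  then have "l2_gain n PP Acl Cz \<le> ereal g"
    unfolding l2_gain_def using g0 by (intro Inf_lower) auto
  also have "\<dots> < ereal \<gamma>" using g\<gamma> by simp
  finally show ?thesis .
qed

end

subsection \<open>The full-block S-procedure\<close>

lemma kron_vec_zero_right: "kron_vec p (0\<^sub>v n) = 0\<^sub>v (dim_vec p * n)"
proof (rule eq_vecI)
  fix i assume "i < dim_vec (0\<^sub>v (dim_vec p * n) :: real vec)"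
  then have i: "i < dim_vec p * n" by simp
  show "kron_vec p (0\<^sub>v n) $ i = 0\<^sub>v (dim_vec p * n) $ i"
    using i less_mult_imp_div_mod_less[OF i] by (simp add: kron_vec_def)
qed simp

text \<open>Coercivity of the negated LMI matrix, rewritten for vectors: the congruences become
  evaluations of the inner matrices at T y and G y.\<close>

lemma full_block_lmi_bound:
  fixes X W T G :: "real mat"
  assumes X: "X \<in> carrier_mat r r" and T: "T \<in> carrier_mat r k"
    and W: "W \<in> carrier_mat s s" and G: "G \<in> carrier_mat s k"
    and lmi: "nd (transpose_mat T * X * T - transpose_mat G * W * G)"
  obtains \<epsilon> where "\<epsilon> > 0"
    "\<And>y. y \<in> carrier_vec k \<Longrightarrow>
      (T *\<^sub>v y) \<bullet> (X *\<^sub>v (T *\<^sub>v y)) + \<epsilon> * (y \<bullet> y) \<le> (G *\<^sub>v y) \<bullet> (W *\<^sub>v (G *\<^sub>v y))"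
proof -
  let ?M = "transpose_mat T * X * T" and ?N = "transpose_mat G * W * G"
  have Mc: "?M \<in> carrier_mat k k" using T by auto
  have Nc: "?N \<in> carrier_mat k k" using G by auto
  have MN: "?M - ?N \<in> carrier_mat k k" by (rule minus_carrier_mat[OF Nc])
  have "- (?M - ?N) \<in> carrier_mat k k" by (rule uminus_carrier_mat[OF MN])
  then obtain \<epsilon> where \<epsilon>: "\<epsilon> > 0" "\<And>y. y \<in> carrier_vec k \<Longrightarrow> \<epsilon> * (y \<bullet> y) \<le> y \<bullet> (- (?M - ?N) *\<^sub>v y)"
    using pd_lower_bound[OF lmi[unfolded nd_def]] by blast
  show ?thesis
  proof (rule that[OF \<epsilon>(1)])
    fix y :: "real vec" assume y: "y \<in> carrier_vec k"
    have My: "?M *\<^sub>v y \<in> carrier_vec k" by (rule mult_mat_vec_carrier[OF Mc y])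
    have Ny: "?N *\<^sub>v y \<in> carrier_vec k" by (rule mult_mat_vec_carrier[OF Nc y])
    have "- (?M - ?N) *\<^sub>v y = - (?M *\<^sub>v y - ?N *\<^sub>v y)"
      using uminus_mult_mat_vec[of y "?M - ?N"] MN y minus_mult_distrib_mat_vec[OF Mc Nc y] carrier_matD[OF MN] carrier_vecD[OF y]
      by metis
    then have "y \<bullet> (- (?M - ?N) *\<^sub>v y) = y \<bullet> (?N *\<^sub>v y) - y \<bullet> (?M *\<^sub>v y)"
      using scalar_prod_minus_distrib[OF y My Ny] scalar_prod_uminus_right[of y "?M *\<^sub>v y - ?N *\<^sub>v y"]
        carrier_vecD[OF y] carrier_vecD[OF Ny] by simp
    then show "(T *\<^sub>v y) \<bullet> (X *\<^sub>v (T *\<^sub>v y)) + \<epsilon> * (y \<bullet> y) \<le> (G *\<^sub>v y) \<bullet> (W *\<^sub>v (G *\<^sub>v y))"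
      using \<epsilon>(2)[OF y] congruence_quadratic_form[OF X T y] congruence_quadratic_form[OF W G y] by linarith
  qed
qed

text \<open>Closing the loop \<open>r = L\<^sub>1\<^sub>1 q + L\<^sub>1\<^sub>2 v\<close>, \<open>q = \<Delta>(p) r\<close> for \<open>v = [a; b; c; d; e]\<close> gives
  \<open>r = 1 \<otimes> [a; b]\<close> and \<open>q = p \<otimes> [a; b]\<close>. On such vectors the multiplier term is nonnegative by
  the second LMI, and \<open>L\<^sub>2\<^sub>1 q + L\<^sub>2\<^sub>2 v\<close> is the argument of \<open>W\<close> below.\<close>

lemma full_block_lmi_imp_parameter_dependent_bound:
  fixes nx nu np :: nat and \<Xi> W :: "real mat" and PP :: "real vec set"
  defines "L11 \<equiv> 0\<^sub>m (2 * nx * np) (2 * nx * np)"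
  defines "L12 \<equiv> hcat (kron (ones np) (1\<^sub>m (2 * nx))) (0\<^sub>m (2 * nx * np) (2 * nx + nu))"
  defines "L21 \<equiv> vcats
     [0\<^sub>m nx (2 * nx * np),
      kron (1\<^sub>m np) (hcat (1\<^sub>m nx) (0\<^sub>m nx nx)),
      0\<^sub>m nx (2 * nx * np),
      kron (1\<^sub>m np) (hcat (0\<^sub>m nx nx) (1\<^sub>m nx)),
      0\<^sub>m (2 * nx + nu) (2 * nx * np)]"
  defines "L22 \<equiv> blockmat
     [[hcat (1\<^sub>m nx) (0\<^sub>m nx nx), 0\<^sub>m nx (2 * nx + nu)],
      [kron (ones np) (0\<^sub>m nx (2 * nx)), 0\<^sub>m (np * nx) (2 * nx + nu)],
      [hcat (0\<^sub>m nx nx) (1\<^sub>m nx), 0\<^sub>m nx (2 * nx + nu)],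
      [kron (ones np) (0\<^sub>m nx (2 * nx)), 0\<^sub>m (np * nx) (2 * nx + nu)],
      [0\<^sub>m (2 * nx + nu) (2 * nx), 1\<^sub>m (2 * nx + nu)]]"
  defines "Delta \<equiv> (\<lambda>p. kron (mat_diag np (\<lambda>i. p $ i)) (1\<^sub>m (2 * nx)))"
  defines "T \<equiv> blockmat [[L11, L12], [1\<^sub>m (2 * nx * np), 0\<^sub>m (2 * nx * np) (4 * nx + nu)]]"
  assumes Xi: "\<Xi> \<in> carrier_mat (4 * np * nx) (4 * np * nx)"
    and W: "W \<in> carrier_mat (2 * (nx * (1 + np)) + (2 * nx + nu)) (2 * (nx * (1 + np)) + (2 * nx + nu))"
    and PP: "PP \<subseteq> carrier_vec np"
    and LMI1: "nd (transpose_mat T * \<Xi> * T - transpose_mat (hcat L21 L22) * W * hcat L21 L22)"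
    and LMI2: "\<And>p. p \<in> PP \<Longrightarrow>
        psd (transpose_mat (vcat (1\<^sub>m (2 * nx * np)) (Delta p)) * \<Xi> * vcat (1\<^sub>m (2 * nx * np)) (Delta p))"
  obtains \<epsilon> where "\<epsilon> > 0"
    "\<And>p a b c d e. p \<in> PP \<Longrightarrow> a \<in> carrier_vec nx \<Longrightarrow> b \<in> carrier_vec nx \<Longrightarrow> c \<in> carrier_vec nx \<Longrightarrow>
      d \<in> carrier_vec nu \<Longrightarrow> e \<in> carrier_vec nx \<Longrightarrow>
      \<epsilon> * (a \<bullet> a + b \<bullet> b + c \<bullet> c + d \<bullet> d + e \<bullet> e)
      \<le> ((a @\<^sub>v kron_vec p a) @\<^sub>v (b @\<^sub>v kron_vec p b) @\<^sub>v c @\<^sub>v d @\<^sub>v e) \<bullet>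
        (W *\<^sub>v ((a @\<^sub>v kron_vec p a) @\<^sub>v (b @\<^sub>v kron_vec p b) @\<^sub>v c @\<^sub>v d @\<^sub>v e))"
proof -
  let ?k = "2 * nx * np + (4 * nx + nu)"
  let ?s = "2 * (nx * (1 + np)) + (2 * nx + nu)"
  have comm: "np * (nx + nx) = 2 * nx * np" "np * (2 * nx) = 2 * nx * np" by (simp_all add: algebra_simps)
  have L11d: "dim_row L11 = 2 * nx * np" "dim_col L11 = 2 * nx * np" by (simp_all add: L11_def)
  have L12d: "dim_row L12 = 2 * nx * np" "dim_col L12 = 2 * nx + (2 * nx + nu)" by (simp_all add: L12_def)
  have L21d: "dim_row L21 = ?s" "dim_col L21 = 2 * nx * np" by (simp_all add: L21_def algebra_simps)
  have L22d: "dim_row L22 = ?s" "dim_col L22 = 2 * nx + (2 * nx + nu)"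
    by (simp_all add: L22_def blockmat_def algebra_simps)
  have Tc: "T \<in> carrier_mat (4 * np * nx) ?k"
    by (rule carrier_matI) (simp_all add: T_def blockmat_def L11d L12d)
  have Gc: "hcat L21 L22 \<in> carrier_mat ?s ?k"
    by (rule carrier_matI) (simp_all add: L21d L22d)
  obtain \<epsilon> where \<epsilon>: "\<epsilon> > 0" "\<And>y. y \<in> carrier_vec ?k \<Longrightarrow>
      (T *\<^sub>v y) \<bullet> (\<Xi> *\<^sub>v (T *\<^sub>v y)) + \<epsilon> * (y \<bullet> y) \<le> (hcat L21 L22 *\<^sub>v y) \<bullet> (W *\<^sub>v (hcat L21 L22 *\<^sub>v y))"
    using full_block_lmi_bound[OF Xi Tc W Gc LMI1] by blast
  show ?thesis
  proof (rule that[OF \<epsilon>(1)])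
    fix p a b c d e :: "real vec"
    assume p: "p \<in> PP" and car: "a \<in> carrier_vec nx" "b \<in> carrier_vec nx" "c \<in> carrier_vec nx"
      "d \<in> carrier_vec nu" "e \<in> carrier_vec nx"
    have pc: "p \<in> carrier_vec np" using PP p by blast
    note dims = car[THEN carrier_vecD] carrier_vecD[OF pc]
    let ?ab = "a @\<^sub>v b" and ?cde = "c @\<^sub>v d @\<^sub>v e"
    let ?one = "vec np (\<lambda>_. 1) :: real vec"
    define q where "q = kron_vec p ?ab"
    define r where "r = kron_vec ?one ?ab"
    have qd: "dim_vec q = 2 * nx * np" and rd: "dim_vec r = 2 * nx * np"
      by (simp_all add: q_def r_def dims comm)
    have abd: "dim_vec ?ab = 2 * nx" and cded: "dim_vec ?cde = 2 * nx + nu"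
      by (simp_all add: dims)
    have L12v: "L12 *\<^sub>v (?ab @\<^sub>v ?cde) = r"
    proof -
      have "L12 *\<^sub>v (?ab @\<^sub>v ?cde) = kron (ones np) (1\<^sub>m (2 * nx)) *\<^sub>v ?ab + 0\<^sub>m (2 * nx * np) (2 * nx + nu) *\<^sub>v ?cde"
        unfolding L12_def by (rule hcat_mult_append) (simp_all add: abd cded dims)
      also have "\<dots> = r + 0\<^sub>v (2 * nx * np)"
        by (simp add: kron_ones_mult_vec zero_mat_mult_vec_dim one_mat_mult_vec_dim r_def dims)
      finally show ?thesis using add_zero_vec_dim(1)[OF rd] by simp
    qed
    have Ty: "T *\<^sub>v (q @\<^sub>v ?ab @\<^sub>v ?cde) = r @\<^sub>v q"
    proof -
      have "L11 *\<^sub>v q = 0\<^sub>v (2 * nx * np)" unfolding L11_def by (rule zero_mat_mult_vec_dim[OF qd])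
      moreover have "0\<^sub>m (2 * nx * np) (4 * nx + nu) *\<^sub>v (?ab @\<^sub>v ?cde) = 0\<^sub>v (2 * nx * np)"
        by (rule zero_mat_mult_vec_dim) (simp add: dims)
      moreover have "1\<^sub>m (2 * nx * np) *\<^sub>v q = q" by (rule one_mat_mult_vec_dim[OF qd])
      moreover have "hcat L11 L12 *\<^sub>v (q @\<^sub>v ?ab @\<^sub>v ?cde) = L11 *\<^sub>v q + L12 *\<^sub>v (?ab @\<^sub>v ?cde)"
        by (rule hcat_mult_append) (simp_all add: L11d L12d qd dims)
      moreover have "hcat (1\<^sub>m (2 * nx * np)) (0\<^sub>m (2 * nx * np) (4 * nx + nu)) *\<^sub>v (q @\<^sub>v ?ab @\<^sub>v ?cde)
         = 1\<^sub>m (2 * nx * np) *\<^sub>v q + 0\<^sub>m (2 * nx * np) (4 * nx + nu) *\<^sub>v (?ab @\<^sub>v ?cde)"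
        by (rule hcat_mult_append) (simp_all add: qd dims)
      moreover have "T = vcat (hcat L11 L12) (hcat (1\<^sub>m (2 * nx * np)) (0\<^sub>m (2 * nx * np) (4 * nx + nu)))"
        by (simp add: T_def blockmat_def)
      ultimately show ?thesis
        using vcat_mult_vec[of "hcat L11 L12" "hcat (1\<^sub>m (2 * nx * np)) (0\<^sub>m (2 * nx * np) (4 * nx + nu))" "q @\<^sub>v ?ab @\<^sub>v ?cde"]
        by (simp add: L12v add_zero_vec_dim qd rd L11d L12d)
    qed
    have Xi_nonneg: "0 \<le> (r @\<^sub>v q) \<bullet> (\<Xi> *\<^sub>v (r @\<^sub>v q))"
    proof -
      let ?V = "vcat (1\<^sub>m (2 * nx * np)) (Delta p)"
      have dD: "dim_row (Delta p) = 2 * nx * np" "dim_col (Delta p) = 2 * nx * np"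
        by (simp_all add: Delta_def mat_diag_def)
      have Vc: "?V \<in> carrier_mat (4 * np * nx) (2 * nx * np)"
        by (rule carrier_matI) (simp_all add: dD)
      have rc: "r \<in> carrier_vec (2 * nx * np)" by (rule carrier_vecI[OF rd])
      have "Delta p *\<^sub>v r = q"
        unfolding Delta_def r_def q_def
        using kron_mult_kron_vec[of "mat_diag np (($) p)" ?one "1\<^sub>m (2 * nx)" ?ab]
          mat_diag_mult_ones[OF pc] one_mat_mult_vec_dim[OF abd] abd by (simp add: mat_diag_def)
      then have Vr: "?V *\<^sub>v r = r @\<^sub>v q"
        by (simp add: vcat_mult_vec dD one_mat_mult_vec_dim rd)
      have "transpose_mat ?V * \<Xi> * ?V \<in> carrier_mat (2 * nx * np) (2 * nx * np)" using Vc by auto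
      then show ?thesis
        using psdD(2)[OF LMI2[OF p] _ rc] congruence_quadratic_form[OF Xi Vc rc] unfolding Vr by simp
    qed
    have L21q: "L21 *\<^sub>v q = 0\<^sub>v nx @\<^sub>v kron_vec p a @\<^sub>v 0\<^sub>v nx @\<^sub>v kron_vec p b @\<^sub>v 0\<^sub>v (2 * nx + nu)"
    proof -
      have "hcat (1\<^sub>m nx) (0\<^sub>m nx nx) *\<^sub>v ?ab = a" "hcat (0\<^sub>m nx nx) (1\<^sub>m nx) *\<^sub>v ?ab = b"
        by (simp_all add: hcat_mult_append dims one_mat_mult_vec_dim zero_mat_mult_vec_dim add_zero_vec_dim)
      then have "kron (1\<^sub>m np) (hcat (1\<^sub>m nx) (0\<^sub>m nx nx)) *\<^sub>v q = kron_vec p a"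
        "kron (1\<^sub>m np) (hcat (0\<^sub>m nx nx) (1\<^sub>m nx)) *\<^sub>v q = kron_vec p b"
        unfolding q_def by (simp_all add: kron_one_mult_kron_vec dims)
      then show ?thesis
        by (simp add: L21_def vcat_mult_vec comm zero_mat_mult_vec_dim qd)
    qed
    have L22v: "L22 *\<^sub>v (?ab @\<^sub>v ?cde) = a @\<^sub>v 0\<^sub>v (np * nx) @\<^sub>v b @\<^sub>v 0\<^sub>v (np * nx) @\<^sub>v ?cde"
      by (simp add: L22_def blockmat_def vcat_mult_vec hcat_mult_append dims one_mat_mult_vec_dim
          zero_mat_mult_vec_dim add_zero_vec_dim kron_ones_mult_vec kron_vec_zero_right)
    let ?v = "(a @\<^sub>v kron_vec p a) @\<^sub>v (b @\<^sub>v kron_vec p b) @\<^sub>v c @\<^sub>v d @\<^sub>v e"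
    \<comment> \<open>The zero blocks in the image of \<open>L22\<close> are exactly where
      \<open>L21\<close> places p \<otimes> a and p \<otimes> b, so the sum interleaves them into
      two lifted vectors.\<close>
    have Gy: "hcat L21 L22 *\<^sub>v (q @\<^sub>v ?ab @\<^sub>v ?cde) = ?v"
    proof -
      have "hcat L21 L22 *\<^sub>v (q @\<^sub>v ?ab @\<^sub>v ?cde) = L21 *\<^sub>v q + L22 *\<^sub>v (?ab @\<^sub>v ?cde)"
        by (rule hcat_mult_append) (simp_all add: L21d L22d qd dims)
      then show ?thesis
        unfolding L21q L22v by (simp add: append_vec_add_dim add_zero_vec_dim dims append_vec_assoc)
    qed
    have yc: "q @\<^sub>v ?ab @\<^sub>v ?cde \<in> carrier_vec ?k" by (rule carrier_vecI) (simp add: qd dims)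
    \<comment> \<open>Dropping |q|^2 removes the only part of the margin that depends on p.\<close>
    have "a \<bullet> a + b \<bullet> b + c \<bullet> c + d \<bullet> d + e \<bullet> e \<le> (q @\<^sub>v ?ab @\<^sub>v ?cde) \<bullet> (q @\<^sub>v ?ab @\<^sub>v ?cde)"
      by (simp add: scalar_prod_append_dim scalar_prod_self_nonneg)
    then have "\<epsilon> * (a \<bullet> a + b \<bullet> b + c \<bullet> c + d \<bullet> d + e \<bullet> e) \<le> \<epsilon> * ((q @\<^sub>v ?ab @\<^sub>v ?cde) \<bullet> (q @\<^sub>v ?ab @\<^sub>v ?cde))"
      using \<epsilon>(1) by (intro mult_left_mono) auto
    then show "\<epsilon> * (a \<bullet> a + b \<bullet> b + c \<bullet> c + d \<bullet> d + e \<bullet> e) \<le> ?v \<bullet> (W *\<^sub>v ?v)"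
      using \<epsilon>(2)[OF yc] Xi_nonneg unfolding Ty Gy by linarith
  qed
qed

subsection \<open>Data-based closed-loop representation\<close>

lemma col_mult:
  fixes A B :: "real mat"
  assumes "A \<in> carrier_mat r k" "B \<in> carrier_mat k n" "j < n"
  shows "col (A * B) j = A *\<^sub>v col B j"
  by (rule eq_vecI) (use assms in auto)

lemma col_vcat:
  assumes "dim_col A = dim_col B" "j < dim_col A"
  shows "col (vcat A B) j = col A j @\<^sub>v col B j"
  by (rule eq_vecI) (use assms in \<open>auto simp: vcat_def\<close>)

text \<open>Every data column obeys the plant equation, so X_+ is the unknown row [A_0 ... B_0 ...]
  times the data matrix. Any combination f of columns whose image looks like a sample (p, x, u) thus
  reproduces the plant response at that sample, measured or not.\<close>

lemma data_equation:
  fixes ud ps_d xd :: "nat \<Rightarrow> real vec"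
  assumes A: "A 0 \<in> carrier_mat nx nx" and B: "B 0 \<in> carrier_mat nx nu"
    and data_dim: "\<And>k. k \<in> {1..Nd} \<Longrightarrow> xd k \<in> carrier_vec nx \<and> ud k \<in> carrier_vec nu \<and> ps_d k \<in> carrier_vec np"
    and data_traj: "\<And>k. k \<in> {1..<Nd} \<Longrightarrow> xd (k + 1) = aff A np (ps_d k) *\<^sub>v xd k + aff B np (ps_d k) *\<^sub>v ud k"
    and f: "f \<in> carrier_vec (Nd - 1)" and x: "x \<in> carrier_vec nx" and u: "u \<in> carrier_vec nu" and p: "p \<in> carrier_vec np"
    and Df: "Dp nx nu np Nd ud ps_d xd *\<^sub>v f = x @\<^sub>v kron_vec p x @\<^sub>v u @\<^sub>v kron_vec p u"
  shows "Xplus nx Nd xd *\<^sub>v f = aff A np p *\<^sub>v x + aff B np p *\<^sub>v u"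
proof -
  let ?D = "Dp nx nu np Nd ud ps_d xd"
  let ?h = "nx + (np * nx + (nu + np * nu))"
  define M where "M = hcat (A 0) (hcat (coeff_stack A np) (hcat (B 0) (coeff_stack B np)))"
  note ABd = carrier_matD[OF A] carrier_matD[OF B]
  have M: "M \<in> carrier_mat nx ?h"
    by (rule carrier_matI) (simp_all add: M_def ABd)
  have blocks: "dim_row (Umat nx Nd xd) = nx" "dim_col (Umat nx Nd xd) = Nd - 1"
    "dim_row (Upmat np nx Nd ps_d xd) = np * nx" "dim_col (Upmat np nx Nd ps_d xd) = Nd - 1"
    "dim_row (Umat nu Nd ud) = nu" "dim_col (Umat nu Nd ud) = Nd - 1"
    "dim_row (Upmat np nu Nd ps_d ud) = np * nu" "dim_col (Upmat np nu Nd ps_d ud) = Nd - 1"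
    by (simp_all add: Umat_def Upmat_def)
  have D: "?D \<in> carrier_mat ?h (Nd - 1)"
    by (rule carrier_matI) (simp_all add: Dp_def blocks)
  have Xp: "Xplus nx Nd xd \<in> carrier_mat nx (Nd - 1)"
    by (rule carrier_matI) (auto simp: Xplus_def)
  have aff_block: "M *\<^sub>v (y @\<^sub>v kron_vec s y @\<^sub>v v @\<^sub>v kron_vec s v) = aff A np s *\<^sub>v y + aff B np s *\<^sub>v v"
    if y: "y \<in> carrier_vec nx" and v: "v \<in> carrier_vec nu" and s: "s \<in> carrier_vec np" for y v s
  proof -
    note dims = carrier_vecD[OF y] carrier_vecD[OF v] carrier_vecD[OF s]
    have yA: "y \<in> carrier_vec (dim_col (A 0))" and vB: "v \<in> carrier_vec (dim_col (B 0))"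
      using y v A B by auto
    have "M *\<^sub>v (y @\<^sub>v kron_vec s y @\<^sub>v v @\<^sub>v kron_vec s v)
        = A 0 *\<^sub>v y + (coeff_stack A np *\<^sub>v kron_vec s y + (B 0 *\<^sub>v v + coeff_stack B np *\<^sub>v kron_vec s v))"
      by (simp add: M_def hcat_mult_append ABd dims)
    also have "\<dots> = (A 0 *\<^sub>v y + coeff_stack A np *\<^sub>v kron_vec s y) + (B 0 *\<^sub>v v + coeff_stack B np *\<^sub>v kron_vec s v)"
      by (rule assoc_add_vec[symmetric, of _ nx]) (auto intro!: carrier_vecI simp: ABd)
    finally show ?thesis unfolding aff_mult_vec[where M = A, OF s yA] aff_mult_vec[where M = B, OF s vB] .
  qed
  have "Xplus nx Nd xd = M * ?D"
  proof (rule mat_col_eqI)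
    fix j assume "j < dim_col (M * ?D)"
    then have j: "j < Nd - 1" using D by simp
    \<comment> \<open>Column j, counted from 0, holds sample j + 1, and the matching column of
      \<open>Xplus\<close> holds sample j + 2.\<close>
    let ?k = "j + 1"
    have k: "?k \<in> {1..<Nd}" "?k \<in> {1..Nd}" "Suc ?k \<in> {1..Nd}" using j by auto
    have kd: "xd ?k \<in> carrier_vec nx" "ud ?k \<in> carrier_vec nu" "ps_d ?k \<in> carrier_vec np" "xd (Suc ?k) \<in> carrier_vec nx"
      using data_dim[OF k(2)] data_dim[OF k(3)] by auto
    have nth1: "map g [1..<Nd] ! j = g ?k" for g :: "nat \<Rightarrow> real vec" using j by (simp add: add.commute)
    have kx: "kron_vec (ps_d ?k) (xd ?k) \<in> carrier_vec (np * nx)" and ku: "kron_vec (ps_d ?k) (ud ?k) \<in> carrier_vec (np * nu)"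
      by (rule carrier_vecI, use kd in simp)+
    have c1: "col (Umat nx Nd xd) j = xd ?k"
      unfolding Umat_def using j kd nth1[of xd] by (subst col_mat_of_cols) simp_all
    have c2: "col (Upmat np nx Nd ps_d xd) j = kron_vec (ps_d ?k) (xd ?k)"
      unfolding Upmat_def using j kx nth1[of "\<lambda>k. kron_vec (ps_d k) (xd k)"] by (subst col_mat_of_cols) simp_all
    have c3: "col (Umat nu Nd ud) j = ud ?k"
      unfolding Umat_def using j kd nth1[of ud] by (subst col_mat_of_cols) simp_all
    have c4: "col (Upmat np nu Nd ps_d ud) j = kron_vec (ps_d ?k) (ud ?k)"
      unfolding Upmat_def using j ku nth1[of "\<lambda>k. kron_vec (ps_d k) (ud k)"] by (subst col_mat_of_cols) simp_all
    have "col ?D j = xd ?k @\<^sub>v kron_vec (ps_d ?k) (xd ?k) @\<^sub>v ud ?k @\<^sub>v kron_vec (ps_d ?k) (ud ?k)"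
      using j by (simp add: Dp_def col_vcat blocks c1 c2 c3 c4)
    then have "col (M * ?D) j = aff A np (ps_d ?k) *\<^sub>v xd ?k + aff B np (ps_d ?k) *\<^sub>v ud ?k"
      using col_mult[OF M D j] aff_block[OF kd(1-3)] by simp
    also have "\<dots> = xd (Suc ?k)" using data_traj[OF k(1)] by simp
    also have "\<dots> = col (Xplus nx Nd xd) j"
    proof -
      have "length [2..<Nd + 1] = Nd - 1" "[2..<Nd + 1] ! j = Suc ?k"
        using j nth_upt[of 2 j "Nd + 1"] by auto
      then show ?thesis
        unfolding Xplus_def using j kd(4)
        by (subst col_mat_of_cols) (simp_all add: nth_map[of j "[2..<Nd + 1]"] del: upt_Suc)
    qed
    finally show "col (Xplus nx Nd xd) j = col (M * ?D) j" ..
  qed (use M D Xp in auto)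
  then have "Xplus nx Nd xd *\<^sub>v f = M *\<^sub>v (?D *\<^sub>v f)"
    using assoc_mult_mat_vec[OF M D f] by simp
  then show ?thesis unfolding Df aff_block[OF x u p] .
qed

text \<open>Passing to the bilinear form moves X onto the test vector b. Lifting commutes with the
  block-diagonal data matrix, [X^T b; p \<otimes> X^T b] being the transposed block-diagonal matrix
  applied to [b; p \<otimes> b], so the left factor [I; p \<otimes> I]^T of the \<open>FF\<close>
  identity is absorbed into b.\<close>

lemma lifted_bilinear_form:
  fixes X FF FQ :: "real mat"
  assumes X: "X \<in> carrier_mat nx N" and FQ: "FQ \<in> carrier_mat (N * (1 + np)) (nx * (1 + np))"
    and FF: "FF \<in> carrier_mat N (nx * (1 + np + np ^ 2))"
    and p: "p \<in> carrier_vec np" and a: "a \<in> carrier_vec nx" and b: "b \<in> carrier_vec nx"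
    and eq: "FF * vcats [1\<^sub>m nx, kron (colmat p) (1\<^sub>m nx), kron (kron (colmat p) (colmat p)) (1\<^sub>m nx)]
      = transpose_mat (vcats [1\<^sub>m N, kron (colmat p) (1\<^sub>m N)]) * FQ * vcats [1\<^sub>m nx, kron (colmat p) (1\<^sub>m nx)]"
  shows "(b @\<^sub>v kron_vec p b) \<bullet> ((blkdiag X (kron (1\<^sub>m np) X) * FQ) *\<^sub>v (a @\<^sub>v kron_vec p a))
    = b \<bullet> (X *\<^sub>v (FF *\<^sub>v (a @\<^sub>v kron_vec p a @\<^sub>v kron_vec p (kron_vec p a))))"
proof -
  note Xd = carrier_matD[OF X] and dims = carrier_vecD[OF p] carrier_vecD[OF a] carrier_vecD[OF b]
  let ?sa = "a @\<^sub>v kron_vec p a" and ?sb = "b @\<^sub>v kron_vec p b"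
  let ?s3 = "a @\<^sub>v kron_vec p a @\<^sub>v kron_vec p (kron_vec p a)"
  define Z where "Z = blkdiag X (kron (1\<^sub>m np) X)"
  have Zblock: "Z = vcat (hcat X (0\<^sub>m nx (np * N))) (hcat (0\<^sub>m (np * nx) N) (kron (1\<^sub>m np) X))"
    by (simp add: Z_def blkdiag_def blockmat_def Xd)
  have Z: "Z \<in> carrier_mat (nx * (1 + np)) (N * (1 + np))"
    by (rule carrier_matI) (simp_all add: Zblock Xd algebra_simps)
  define E1 where "E1 = vcats [1\<^sub>m nx, kron (colmat p) (1\<^sub>m nx)]"
  define E2 where "E2 = vcats [1\<^sub>m nx, kron (colmat p) (1\<^sub>m nx), kron (kron (colmat p) (colmat p)) (1\<^sub>m nx)]"
  define EN where "EN = vcats [1\<^sub>m N, kron (colmat p) (1\<^sub>m N)]"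
  have E1: "E1 \<in> carrier_mat (nx * (1 + np)) nx"
    by (rule carrier_matI) (simp_all add: E1_def dims algebra_simps)
  have E2: "E2 \<in> carrier_mat (nx * (1 + np + np ^ 2)) nx"
    by (rule carrier_matI) (simp_all add: E2_def dims algebra_simps power2_eq_square)
  have EN: "EN \<in> carrier_mat (N * (1 + np)) N"
    by (rule carrier_matI) (simp_all add: EN_def dims algebra_simps)
  have ENt: "transpose_mat EN \<in> carrier_mat N (N * (1 + np))" using EN by simp
  have E1a: "E1 *\<^sub>v a = ?sa"
    by (simp add: E1_def vcat_mult_vec one_mat_mult_vec_dim kron_colmat_mult_vec dims)
  have E2a: "E2 *\<^sub>v a = ?s3"
    by (simp add: E2_def vcat_mult_vec one_mat_mult_vec_dim kron_colmat_mult_vec kron_colmat_colmat_mult_vec dims)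
  have sac: "?sa \<in> carrier_vec (nx * (1 + np))" unfolding E1a[symmetric] by (rule mult_mat_vec_carrier[OF E1 a])
  define y where "y = FQ *\<^sub>v ?sa"
  have y: "y \<in> carrier_vec (N * (1 + np))" unfolding y_def by (rule mult_mat_vec_carrier[OF FQ sac])
  have "FF *\<^sub>v ?s3 = (FF * E2) *\<^sub>v a"
    unfolding E2a[symmetric] by (rule assoc_mult_mat_vec[OF FF E2 a, symmetric])
  also have "\<dots> = (transpose_mat EN * FQ * E1) *\<^sub>v a"
    using eq by (simp add: E1_def E2_def EN_def)
  also have "\<dots> = (transpose_mat EN * FQ) *\<^sub>v (E1 *\<^sub>v a)"
    by (rule assoc_mult_mat_vec[OF mult_carrier_mat[OF ENt FQ] E1 a])
  also have "\<dots> = transpose_mat EN *\<^sub>v y"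
    unfolding E1a y_def by (rule assoc_mult_mat_vec[OF ENt FQ sac])
  finally have FFs: "FF *\<^sub>v ?s3 = transpose_mat EN *\<^sub>v y" .
  let ?Xb = "transpose_mat X *\<^sub>v b"
  have Xb: "?Xb \<in> carrier_vec N" using X b by simp
  have ENy: "transpose_mat EN *\<^sub>v y \<in> carrier_vec N" by (rule mult_mat_vec_carrier[OF ENt y])
  have "b \<bullet> (X *\<^sub>v (transpose_mat EN *\<^sub>v y)) = ?Xb \<bullet> (transpose_mat EN *\<^sub>v y)"
    by (rule adjoint_scalar_prod[OF X b ENy])
  also have "\<dots> = (EN *\<^sub>v ?Xb) \<bullet> y"
    using adjoint_scalar_prod[OF ENt Xb y] by simp
  also have "EN *\<^sub>v ?Xb = ?Xb @\<^sub>v kron_vec p ?Xb"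
    by (simp add: EN_def vcat_mult_vec one_mat_mult_vec_dim kron_colmat_mult_vec Xd)
  also have "\<dots> = transpose_mat Z *\<^sub>v ?sb"
  proof -
    have Zt: "transpose_mat Z = vcat (hcat (transpose_mat X) (0\<^sub>m N (np * nx))) (hcat (0\<^sub>m (np * N) nx) (kron (1\<^sub>m np) (transpose_mat X)))"
    proof (rule eq_matI)
      fix i j
      assume "i < dim_row (vcat (hcat (transpose_mat X) (0\<^sub>m N (np * nx))) (hcat (0\<^sub>m (np * N) nx) (kron (1\<^sub>m np) (transpose_mat X))))"
        and "j < dim_col (vcat (hcat (transpose_mat X) (0\<^sub>m N (np * nx))) (hcat (0\<^sub>m (np * N) nx) (kron (1\<^sub>m np) (transpose_mat X))))"
      then have i: "i < N + np * N" and j: "j < nx + np * nx" by (auto simp: Xd)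
      have "kron (1\<^sub>m np) (transpose_mat X) = transpose_mat (kron (1\<^sub>m np) X)"
        by (simp add: transpose_kron)
      then show "transpose_mat Z $$ (i,j) = vcat (hcat (transpose_mat X) (0\<^sub>m N (np * nx))) (hcat (0\<^sub>m (np * N) nx) (kron (1\<^sub>m np) (transpose_mat X))) $$ (i,j)"
        using i j by (auto simp: Zblock vcat_def hcat_def Xd)
    qed (simp_all add: Zblock Xd)
    show ?thesis
      by (simp add: Zt vcat_mult_vec hcat_mult_append Xd dims zero_mat_mult_vec_dim add_zero_vec_dim kron_one_mult_kron_vec)
  qed
  also have "(transpose_mat Z *\<^sub>v ?sb) \<bullet> y = ?sb \<bullet> (Z *\<^sub>v y)"
  proof -
    have "?sb \<in> carrier_vec (nx * (1 + np))"
      by (rule carrier_vecI) (simp add: dims algebra_simps)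
    then show ?thesis using adjoint_scalar_prod[OF Z _ y] by simp
  qed
  also have "Z *\<^sub>v y = (Z * FQ) *\<^sub>v ?sa"
    unfolding y_def by (rule assoc_mult_mat_vec[OF Z FQ sac, symmetric])
  finally show ?thesis unfolding FFs Z_def ..
qed

text \<open>The last block row gives (I \<otimes> Y0)(p \<otimes> a) + (I \<otimes> Ybar)(p
  \<otimes> p \<otimes> a) = p \<otimes> u. The image therefore has the structure of a data column
  for state P a and input u, as \<open>data_equation\<close> demands.\<close>

lemma decomposed_data_image:
  fixes P Y0 Ybar D FF :: "real mat"
  assumes P: "P \<in> carrier_mat nx nx" and Y: "Y0 \<in> carrier_mat nu nx" "Ybar \<in> carrier_mat nu (nx * np)"
    and D: "D \<in> carrier_mat r N" and FF: "FF \<in> carrier_mat N (nx * (1 + np + np ^ 2))"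
    and p: "p \<in> carrier_vec np" and a: "a \<in> carrier_vec nx"
    and eq: "blockmat
        [[P, 0\<^sub>m nx (np * nx), 0\<^sub>m nx (np * np * nx)],
         [0\<^sub>m (np * nx) nx, kron (1\<^sub>m np) P, 0\<^sub>m (np * nx) (np * np * nx)],
         [Y0, Ybar, 0\<^sub>m nu (np * np * nx)],
         [0\<^sub>m (np * nu) nx, kron (1\<^sub>m np) Y0, kron (1\<^sub>m np) Ybar]] = D * FF"
  defines "u \<equiv> Y0 *\<^sub>v a + Ybar *\<^sub>v kron_vec p a"
  shows "D *\<^sub>v (FF *\<^sub>v (a @\<^sub>v kron_vec p a @\<^sub>v kron_vec p (kron_vec p a)))
    = (P *\<^sub>v a) @\<^sub>v kron_vec p (P *\<^sub>v a) @\<^sub>v u @\<^sub>v kron_vec p u"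
proof -
  note dims = carrier_matD[OF P] carrier_matD[OF Y(1)] carrier_matD[OF Y(2)] carrier_vecD[OF p] carrier_vecD[OF a]
  let ?s3 = "a @\<^sub>v kron_vec p a @\<^sub>v kron_vec p (kron_vec p a)"
  have comm: "nx * np = np * nx" "np * (nx * np) = np * np * nx" "np * (np * nx) = np * np * nx"
    by (simp_all add: algebra_simps)
  have s3: "?s3 \<in> carrier_vec (nx * (1 + np + np ^ 2))"
    by (rule carrier_vecI) (simp add: dims algebra_simps power2_eq_square)
  have "D *\<^sub>v (FF *\<^sub>v ?s3) = (D * FF) *\<^sub>v ?s3"
    by (rule assoc_mult_mat_vec[OF D FF s3, symmetric])
  also have "\<dots> = (P *\<^sub>v a) @\<^sub>v kron_vec p (P *\<^sub>v a) @\<^sub>v u @\<^sub>v kron_vec p u"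
    unfolding eq[symmetric] blockmat_def u_def
    by (simp add: vcat_mult_vec hcat_mult_append dims comm zero_mat_mult_vec_dim add_zero_vec_dim
        kron_one_mult_kron_vec kron_vec_add_right)
  finally show ?thesis .
qed

text \<open>Since p \<otimes> P a = (I \<otimes> P)(p \<otimes> a), the chosen inverse of I
  \<otimes> P cancels. The input u of the data image is thus the feedback K(p) at state P a.\<close>

lemma controller_mult_vec:
  fixes P Y0 Ybar :: "real mat"
  assumes P: "P \<in> carrier_mat nx nx" "pd P"
    and Y: "Y0 \<in> carrier_mat nu nx" "Ybar \<in> carrier_mat nu (nx * np)"
    and p: "p \<in> carrier_vec np" and a: "a \<in> carrier_vec nx"
  defines "Kbar \<equiv> Ybar * minv (kron (1\<^sub>m np) P)"
  defines "Kf \<equiv> (\<lambda>i. if i = 0 then Y0 * minv P else mat nu nx (\<lambda>(r, c). Kbar $$ (r, (i - 1) * nx + c)))"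
  shows "aff Kf np p *\<^sub>v (P *\<^sub>v a) = Y0 *\<^sub>v a + Ybar *\<^sub>v kron_vec p a"
proof -
  note inv = pd_minv[OF P(2,1)] and kinv = minv_kron_one[OF P(2,1), of np]
  have Yb: "Ybar \<in> carrier_mat nu (np * nx)" using Y(2) by (simp add: mult.commute)
  have Kb: "Kbar \<in> carrier_mat nu (np * nx)" unfolding Kbar_def by (rule mult_carrier_mat[OF Yb kinv(1)])
  have Kf0: "Kf 0 = Y0 * minv P" by (simp add: Kf_def)
  have K0: "Kf 0 \<in> carrier_mat nu nx" unfolding Kf0 using mult_carrier_mat[OF Y(1) inv(1)] by simp
  have kP: "kron (1\<^sub>m np) P \<in> carrier_mat (np * nx) (np * nx)" by (rule carrier_matI) (use P in simp_all)
  have kpa: "kron_vec p a \<in> carrier_vec (np * nx)" by (rule carrier_vecI) (use p a in simp)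
  have Pa: "P *\<^sub>v a \<in> carrier_vec nx" by (rule mult_mat_vec_carrier[OF P(1) a])
  \<comment> \<open>Cutting \<open>Kbar\<close> into slices of width nx and stacking them again is
    the identity, by quotient and remainder modulo nx.\<close>
  have "coeff_stack Kf np = Kbar"
  proof (rule eq_matI)
    fix i j assume "i < dim_row Kbar" "j < dim_col Kbar"
    then have i: "i < nu" and j: "j < np * nx" using Kb by auto
    show "coeff_stack Kf np $$ (i, j) = Kbar $$ (i, j)"
      using i j less_mult_imp_div_mod_less[OF j] carrier_matD[OF K0]
      by (simp add: coeff_stack_def) (simp add: Kf_def)
  qed (use K0 Kb in auto)
  then have "aff Kf np p *\<^sub>v (P *\<^sub>v a) = (Y0 * minv P) *\<^sub>v (P *\<^sub>v a) + Kbar *\<^sub>v kron_vec p (P *\<^sub>v a)"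
    using aff_mult_vec[of p np "P *\<^sub>v a" Kf] p Pa carrier_matD[OF K0] by (simp add: Kf0)
  moreover have "(Y0 * minv P) *\<^sub>v (P *\<^sub>v a) = Y0 *\<^sub>v a"
  proof -
    have "(Y0 * minv P) *\<^sub>v (P *\<^sub>v a) = Y0 *\<^sub>v (minv P *\<^sub>v (P *\<^sub>v a))"
      by (rule assoc_mult_mat_vec[OF Y(1) inv(1) Pa])
    also have "minv P *\<^sub>v (P *\<^sub>v a) = (minv P * P) *\<^sub>v a"
      by (rule assoc_mult_mat_vec[OF inv(1) P(1) a, symmetric])
    finally show ?thesis unfolding inv(3) using a by simp
  qed
  moreover have "Kbar *\<^sub>v kron_vec p (P *\<^sub>v a) = Ybar *\<^sub>v kron_vec p a"
  proof -
    have "kron_vec p (P *\<^sub>v a) = kron (1\<^sub>m np) P *\<^sub>v kron_vec p a"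
      using p a P by (simp add: kron_one_mult_kron_vec)
    then have "Kbar *\<^sub>v kron_vec p (P *\<^sub>v a) = Kbar *\<^sub>v (kron (1\<^sub>m np) P *\<^sub>v kron_vec p a)" by simp
    also have "\<dots> = Ybar *\<^sub>v (minv (kron (1\<^sub>m np) P) *\<^sub>v (kron (1\<^sub>m np) P *\<^sub>v kron_vec p a))"
      unfolding Kbar_def by (rule assoc_mult_mat_vec[OF Yb kinv(1) mult_mat_vec_carrier[OF kP kpa]])
    also have "minv (kron (1\<^sub>m np) P) *\<^sub>v (kron (1\<^sub>m np) P *\<^sub>v kron_vec p a)
        = (minv (kron (1\<^sub>m np) P) * kron (1\<^sub>m np) P) *\<^sub>v kron_vec p a"
      by (rule assoc_mult_mat_vec[OF kinv(1) kP kpa, symmetric])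
    finally show ?thesis unfolding kinv(2) using kpa by simp
  qed
  ultimately show ?thesis by simp
qed

text \<open>Stationary choice \<open>b = - P\<^sup>-\<^sup>1 (M x + w)\<close>, \<open>c = - S\<^sub>Q x / \<gamma>\<close>, \<open>d = - S\<^sub>R K x / \<gamma>\<close>, \<open>e = w\<close> at \<open>a = P\<^sup>-\<^sup>1 x\<close>,
  which replaces the Schur complement steps of the LMI.\<close>

lemma dissipation_inequality:
  fixes P K M SQ SR :: "real mat"
  assumes P: "P \<in> carrier_mat nx nx" "pd P" and K: "K \<in> carrier_mat nu nx" and M: "M \<in> carrier_mat nx nx"
    and SQ: "SQ \<in> carrier_mat nx nx" and SR: "SR \<in> carrier_mat nu nu"
    and pos: "\<gamma> > 0" "\<epsilon> > 0"
    and x: "x \<in> carrier_vec nx" and w: "w \<in> carrier_vec nx"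
  defines "a \<equiv> minv P *\<^sub>v x"
  assumes form: "\<And>b c d e. b \<in> carrier_vec nx \<Longrightarrow> c \<in> carrier_vec nx \<Longrightarrow> d \<in> carrier_vec nu \<Longrightarrow> e \<in> carrier_vec nx \<Longrightarrow>
      \<epsilon> * (a \<bullet> a + b \<bullet> b + c \<bullet> c + d \<bullet> d + e \<bullet> e)
      \<le> a \<bullet> (P *\<^sub>v a) + 2 * (b \<bullet> (M *\<^sub>v (P *\<^sub>v a))) + b \<bullet> (P *\<^sub>v b)
        + 2 * (c \<bullet> (SQ *\<^sub>v (P *\<^sub>v a))) + \<gamma> * (c \<bullet> c)
        + 2 * (d \<bullet> (SR *\<^sub>v (K *\<^sub>v (P *\<^sub>v a)))) + \<gamma> * (d \<bullet> d)
        + 2 * (e \<bullet> b) + \<gamma> * (e \<bullet> e)"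
  defines "V \<equiv> \<lambda>y. y \<bullet> (minv P *\<^sub>v y)" and "C \<equiv> vcat SQ (SR * K)"
  shows "V (M *\<^sub>v x + w) + ((C *\<^sub>v x) \<bullet> (C *\<^sub>v x)) / \<gamma> \<le> V x + (\<gamma> - \<epsilon>) * (w \<bullet> w) - \<epsilon> * (a \<bullet> a)"
proof -
  note inv = pd_minv[OF P(2,1)]
  have P_inv: "P *\<^sub>v (minv P *\<^sub>v y) = y" if y: "y \<in> carrier_vec nx" for y
  proof -
    have "P *\<^sub>v (minv P *\<^sub>v y) = (P * minv P) *\<^sub>v y"
      by (rule assoc_mult_mat_vec[OF P(1) inv(1) y, symmetric])
    then show ?thesis unfolding inv(2) using y by simp
  qed
  have Pa: "P *\<^sub>v a = x" unfolding a_def by (rule P_inv[OF x])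
  have a: "a \<in> carrier_vec nx" unfolding a_def by (rule mult_mat_vec_carrier[OF inv(1) x])
  have Mx: "M *\<^sub>v x \<in> carrier_vec nx" by (rule mult_mat_vec_carrier[OF M x])
  define y where "y = M *\<^sub>v x + w"
  have y: "y \<in> carrier_vec nx" unfolding y_def by (rule add_carrier_vec[OF Mx w])
  define h where "h = minv P *\<^sub>v y"
  have h: "h \<in> carrier_vec nx" unfolding h_def by (rule mult_mat_vec_carrier[OF inv(1) y])
  have Ph: "P *\<^sub>v h = y" unfolding h_def by (rule P_inv[OF y])
  define s where "s = SQ *\<^sub>v x"
  define t where "t = SR *\<^sub>v (K *\<^sub>v x)"
  have s: "s \<in> carrier_vec nx" unfolding s_def by (rule mult_mat_vec_carrier[OF SQ x])
  have Kx: "K *\<^sub>v x \<in> carrier_vec nu" by (rule mult_mat_vec_carrier[OF K x])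
  have t: "t \<in> carrier_vec nu" unfolding t_def by (rule mult_mat_vec_carrier[OF SR Kx])
  let ?g = "- 1 / \<gamma>"
  have "P *\<^sub>v ((- 1) \<cdot>\<^sub>v h) = (- 1) \<cdot>\<^sub>v y" using mult_mat_vec[OF P(1) h, of "- 1"] Ph by simp
  then have bPb: "((- 1) \<cdot>\<^sub>v h) \<bullet> (P *\<^sub>v ((- 1) \<cdot>\<^sub>v h)) = V y"
    using comm_scalar_prod[OF y h] h y by (simp add: V_def h_def[symmetric])
  have aPa: "a \<bullet> (P *\<^sub>v a) = V x"
    unfolding Pa V_def a_def[symmetric] by (rule comm_scalar_prod[OF a x])
  \<comment> \<open>With e = w the two terms linear in b combine to b . y for the successor state y.
    Counted twice they give -2 V(y), and \<open>bPb\<close> returns V(y), leaving -V(y).\<close>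
  have by0: "((- 1) \<cdot>\<^sub>v h) \<bullet> (M *\<^sub>v x) + w \<bullet> ((- 1) \<cdot>\<^sub>v h) = - V y"
  proof -
    have "V y = (M *\<^sub>v x) \<bullet> h + w \<bullet> h"
      unfolding V_def h_def[symmetric] unfolding y_def by (rule add_scalar_prod_distrib[OF Mx w h])
    then show ?thesis using comm_scalar_prod[OF h Mx] h Mx w by simp
  qed
  \<comment> \<open>The minimum of 2 c . s + \<gamma> |c|^2 over c is -|s|^2 / \<gamma>, attained at
    c = -s / \<gamma>; this yields the output term of the inequality.\<close>
  have gg: "2 * (?g * r) + \<gamma> * (?g * (?g * r)) = - r / \<gamma>" for r using pos by (simp add: field_simps)
  have cc: "2 * ((?g \<cdot>\<^sub>v s) \<bullet> s) + \<gamma> * ((?g \<cdot>\<^sub>v s) \<bullet> (?g \<cdot>\<^sub>v s)) = - (s \<bullet> s) / \<gamma>"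
  proof -
    have "(?g \<cdot>\<^sub>v s) \<bullet> s = ?g * (s \<bullet> s)" by (rule smult_scalar_prod_distrib[OF s s])
    moreover have "(?g \<cdot>\<^sub>v s) \<bullet> (?g \<cdot>\<^sub>v s) = ?g * (?g * (s \<bullet> s))"
      using smult_scalar_prod_distrib[OF s smult_carrier_vec[THEN iffD2, OF s], of ?g ?g] scalar_prod_smult_distrib[OF s s, of ?g] by simp
    ultimately show ?thesis using gg[of "s \<bullet> s"] by simp
  qed
  have dd: "2 * ((?g \<cdot>\<^sub>v t) \<bullet> t) + \<gamma> * ((?g \<cdot>\<^sub>v t) \<bullet> (?g \<cdot>\<^sub>v t)) = - (t \<bullet> t) / \<gamma>"
  proof -
    have "(?g \<cdot>\<^sub>v t) \<bullet> t = ?g * (t \<bullet> t)" by (rule smult_scalar_prod_distrib[OF t t])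
    moreover have "(?g \<cdot>\<^sub>v t) \<bullet> (?g \<cdot>\<^sub>v t) = ?g * (?g * (t \<bullet> t))"
      using smult_scalar_prod_distrib[OF t smult_carrier_vec[THEN iffD2, OF t], of ?g ?g] scalar_prod_smult_distrib[OF t t, of ?g] by simp
    ultimately show ?thesis using gg[of "t \<bullet> t"] by simp
  qed
  have "C *\<^sub>v x = s @\<^sub>v t"
    unfolding C_def s_def t_def using SQ SR K x by (simp add: vcat_mult_vec)
  then have z: "((C *\<^sub>v x) \<bullet> (C *\<^sub>v x)) / \<gamma> = (s \<bullet> s) / \<gamma> + (t \<bullet> t) / \<gamma>"
    by (simp add: scalar_prod_append_dim add_divide_distrib)
  \<comment> \<open>Of the five margin terms two are kept: the one in a yields state decay, the one
    in w the reduced gain.\<close>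
  have "\<epsilon> * (a \<bullet> a + w \<bullet> w) \<le> \<epsilon> * (a \<bullet> a + ((- 1) \<cdot>\<^sub>v h) \<bullet> ((- 1) \<cdot>\<^sub>v h) + (?g \<cdot>\<^sub>v s) \<bullet> (?g \<cdot>\<^sub>v s)
      + (?g \<cdot>\<^sub>v t) \<bullet> (?g \<cdot>\<^sub>v t) + w \<bullet> w)"
    using pos scalar_prod_self_nonneg[of "(- 1) \<cdot>\<^sub>v h"] scalar_prod_self_nonneg[of "?g \<cdot>\<^sub>v s"]
      scalar_prod_self_nonneg[of "?g \<cdot>\<^sub>v t"] by (intro mult_left_mono) linarith+
  then have "\<epsilon> * (a \<bullet> a) + \<epsilon> * (w \<bullet> w) \<le> V x + 2 * (((- 1) \<cdot>\<^sub>v h) \<bullet> (M *\<^sub>v x)) + V y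
        + 2 * ((?g \<cdot>\<^sub>v s) \<bullet> s) + \<gamma> * ((?g \<cdot>\<^sub>v s) \<bullet> (?g \<cdot>\<^sub>v s))
        + 2 * ((?g \<cdot>\<^sub>v t) \<bullet> t) + \<gamma> * ((?g \<cdot>\<^sub>v t) \<bullet> (?g \<cdot>\<^sub>v t))
        + 2 * (w \<bullet> ((- 1) \<cdot>\<^sub>v h)) + \<gamma> * (w \<bullet> w)"
    using form[OF smult_carrier_vec[THEN iffD2, OF h] smult_carrier_vec[THEN iffD2, OF s] smult_carrier_vec[THEN iffD2, OF t] w, of "- 1" ?g ?g]
    unfolding bPb aPa unfolding Pa s_def[symmetric] t_def[symmetric] distrib_left by linarith
  then have "V y + (s \<bullet> s) / \<gamma> + (t \<bullet> t) / \<gamma> \<le> V x + \<gamma> * (w \<bullet> w) - \<epsilon> * (w \<bullet> w) - \<epsilon> * (a \<bullet> a)"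
    using by0 cc dd by linarith
  then show ?thesis unfolding z y_def[symmetric] by (simp add: left_diff_distrib)
qed

theorem theorem6:
  fixes nx nu np Nd :: nat
    and PP :: "real vec set"
    and A B :: "nat \<Rightarrow> real mat"
    and ud ps_d xd :: "nat \<Rightarrow> real vec"
    and \<gamma> :: real
    and Q R P \<Xi> FQ FF Y0 Ybar :: "real mat"
  defines "N \<equiv> Nd - 1"
  defines "D \<equiv> Dp nx nu np Nd ud ps_d xd"
  defines "Xp \<equiv> Xplus nx Nd xd"
  defines "Ycal \<equiv> hcat Y0 Ybar"
  defines "P0 \<equiv> blkdiag P (0\<^sub>m (nx * np) (nx * np))"
  defines "Xcal \<equiv> blkdiag Xp (kron (1\<^sub>m np) Xp)"
  defines "m \<equiv> nx * (1 + np)"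
  defines "W \<equiv> blockmat
     [[P0, transpose_mat (Xcal * FQ), transpose_mat (hcat (msqrt Q * P) (0\<^sub>m nx (nx * np))),
         transpose_mat (msqrt R * Ycal), 0\<^sub>m m nx],
      [Xcal * FQ, P0, 0\<^sub>m m nx, 0\<^sub>m m nu, transpose_mat (hcat (1\<^sub>m nx) (0\<^sub>m nx (nx * np)))],
      [hcat (msqrt Q * P) (0\<^sub>m nx (nx * np)), 0\<^sub>m nx m, \<gamma> \<cdot>\<^sub>m 1\<^sub>m nx, 0\<^sub>m nx nu, 0\<^sub>m nx nx],
      [msqrt R * Ycal, 0\<^sub>m nu m, 0\<^sub>m nu nx, \<gamma> \<cdot>\<^sub>m 1\<^sub>m nu, 0\<^sub>m nu nx],
      [0\<^sub>m nx m, hcat (1\<^sub>m nx) (0\<^sub>m nx (nx * np)), 0\<^sub>m nx nx, 0\<^sub>m nx nu, \<gamma> \<cdot>\<^sub>m 1\<^sub>m nx]]"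
  defines "L11 \<equiv> 0\<^sub>m (2 * nx * np) (2 * nx * np)"
  defines "L12 \<equiv> hcat (kron (ones np) (1\<^sub>m (2 * nx))) (0\<^sub>m (2 * nx * np) (2 * nx + nu))"
  defines "L21 \<equiv> vcats
     [0\<^sub>m nx (2 * nx * np),
      kron (1\<^sub>m np) (hcat (1\<^sub>m nx) (0\<^sub>m nx nx)),
      0\<^sub>m nx (2 * nx * np),
      kron (1\<^sub>m np) (hcat (0\<^sub>m nx nx) (1\<^sub>m nx)),
      0\<^sub>m (2 * nx + nu) (2 * nx * np)]"
  defines "L22 \<equiv> blockmat
     [[hcat (1\<^sub>m nx) (0\<^sub>m nx nx), 0\<^sub>m nx (2 * nx + nu)],
      [kron (ones np) (0\<^sub>m nx (2 * nx)), 0\<^sub>m (np * nx) (2 * nx + nu)],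
      [hcat (0\<^sub>m nx nx) (1\<^sub>m nx), 0\<^sub>m nx (2 * nx + nu)],
      [kron (ones np) (0\<^sub>m nx (2 * nx)), 0\<^sub>m (np * nx) (2 * nx + nu)],
      [0\<^sub>m (2 * nx + nu) (2 * nx), 1\<^sub>m (2 * nx + nu)]]"
  defines "Delta \<equiv> (\<lambda>p. kron (mat_diag np (\<lambda>i. p $ i)) (1\<^sub>m (2 * nx)))"
  defines "K0 \<equiv> Y0 * minv P"
  defines "Kbar \<equiv> Ybar * minv (kron (1\<^sub>m np) P)"
  defines "Kf \<equiv> (\<lambda>i. if i = 0 then K0 else mat nu nx (\<lambda>(r, c). Kbar $$ (r, (i - 1) * nx + c)))"
  defines "K \<equiv> aff Kf np"
  defines "Acl \<equiv> (\<lambda>p. aff A np p + aff B np p * K p)"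
  defines "Cz \<equiv> (\<lambda>p. vcat (msqrt Q) (msqrt R * K p))"
  assumes PP: "compact_convex_sched np PP"
    and A_dim: "\<forall>i\<le>np. A i \<in> carrier_mat nx nx"
    and B_dim: "\<forall>i\<le>np. B i \<in> carrier_mat nx nu"
    and data_dim: "\<forall>k\<in>{1..Nd}. xd k \<in> carrier_vec nx \<and> ud k \<in> carrier_vec nu \<and> ps_d k \<in> PP"
    and data_traj: "\<forall>k\<in>{1..<Nd}. xd (k + 1) = aff A np (ps_d k) *\<^sub>v xd k + aff B np (ps_d k) *\<^sub>v ud k"
    and rank: "vec_space.rank (dim_row D) D = (1 + np) * (nx + nu)"
    and gamma: "\<gamma> > 0"
    and Q: "Q \<in> carrier_mat nx nx" "psd Q"
    and R: "R \<in> carrier_mat nu nu" "pd R"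
    and P: "P \<in> carrier_mat nx nx" "pd P"
    and Xi: "\<Xi> \<in> carrier_mat (4 * np * nx) (4 * np * nx)" "sym_mat \<Xi>"
    and FQ: "FQ \<in> carrier_mat (N * (1 + np)) (nx * (1 + np))"
    and FF: "FF \<in> carrier_mat N (nx * (1 + np + np ^ 2))"
    and FF_eq: "\<forall>p\<in>PP.
        FF * vcats [1\<^sub>m nx, kron (colmat p) (1\<^sub>m nx), kron (kron (colmat p) (colmat p)) (1\<^sub>m nx)]
      = transpose_mat (vcats [1\<^sub>m N, kron (colmat p) (1\<^sub>m N)]) * FQ
          * vcats [1\<^sub>m nx, kron (colmat p) (1\<^sub>m nx)]"
    and Y: "Y0 \<in> carrier_mat nu nx" "Ybar \<in> carrier_mat nu (nx * np)"
    and D_eq: "blockmat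
        [[P, 0\<^sub>m nx (np * nx), 0\<^sub>m nx (np * np * nx)],
         [0\<^sub>m (np * nx) nx, kron (1\<^sub>m np) P, 0\<^sub>m (np * nx) (np * np * nx)],
         [Y0, Ybar, 0\<^sub>m nu (np * np * nx)],
         [0\<^sub>m (np * nu) nx, kron (1\<^sub>m np) Y0, kron (1\<^sub>m np) Ybar]] = D * FF"
    and LMI1: "\<forall>p\<in>PP.
        nd (transpose_mat (blockmat [[L11, L12], [1\<^sub>m (2 * nx * np), 0\<^sub>m (2 * nx * np) (4 * nx + nu)]]) * \<Xi>
              * blockmat [[L11, L12], [1\<^sub>m (2 * nx * np), 0\<^sub>m (2 * nx * np) (4 * nx + nu)]]
            - transpose_mat (hcat L21 L22) * W * hcat L21 L22)"
    and LMI2: "\<forall>p\<in>PP.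
        psd (transpose_mat (vcat (1\<^sub>m (2 * nx * np)) (Delta p)) * \<Xi> * vcat (1\<^sub>m (2 * nx * np)) (Delta p))"
  shows "stabilizing nx PP Acl \<and> l2_gain nx PP Acl Cz < ereal \<gamma>"
proof -
  have PPc: "PP \<subseteq> carrier_vec np" using PP by (simp add: compact_convex_sched_def)
  have SQ: "msqrt Q \<in> carrier_mat nx nx" by (rule msqrt_carrier_mat[OF Q(2,1)])
  have SR: "msqrt R \<in> carrier_mat nu nu" by (rule msqrt_carrier_mat[OF pd_imp_psd[OF R(2)] R(1)])
  note inv = pd_minv[OF P(2,1)]
  note ABd = A_dim[rule_format, OF le0] B_dim[rule_format, OF le0]
  have K: "K p \<in> carrier_mat nu nx" for p
    unfolding K_def
    by (rule carrier_matI) (use Y(1) inv(1) in \<open>simp_all add: Kf_def K0_def\<close>)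
  have affA: "aff A np p \<in> carrier_mat nx nx" for p
    by (rule carrier_matI) (use ABd in simp_all)
  have affB: "aff B np p \<in> carrier_mat nx nu" for p
    by (rule carrier_matI) (use ABd in simp_all)
  have AK: "Acl p \<in> carrier_mat nx nx" for p
    unfolding Acl_def by (rule add_carrier_mat[OF mult_carrier_mat[OF affB K]])
  obtain c1 where c1: "c1 > 0" "\<And>x. x \<in> carrier_vec nx \<Longrightarrow> c1 * (x \<bullet> x) \<le> x \<bullet> (minv P *\<^sub>v x)"
    using pd_lower_bound[OF inv(4,1)] by blast
  obtain c2 where c2: "c2 > 0" "\<And>x. x \<in> carrier_vec nx \<Longrightarrow> x \<bullet> (minv P *\<^sub>v x) \<le> c2 * (x \<bullet> x)"
    using symmetric_quadratic_form_upper_bound[OF inv(1) pdD(1)[OF inv(4,1)]] by blast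
  \<comment> \<open>Used at a = P^-1 x: it converts the margin \<epsilon> |a|^2 into \<epsilon> / c3
    times |x|^2, hence the choice of \<delta> below.\<close>
  obtain c3 where c3: "c3 > 0" "\<And>x. x \<in> carrier_vec nx \<Longrightarrow> (P *\<^sub>v x) \<bullet> (P *\<^sub>v x) \<le> c3 * (x \<bullet> x)"
    using mult_vec_scalar_prod_self_bound[OF P(1)] by blast
  have "\<exists>\<epsilon> \<delta>. strictly_dissipative nx PP Acl Cz (\<lambda>x. x \<bullet> (minv P *\<^sub>v x)) c1 c2 \<gamma> \<epsilon> \<delta>"
  \<comment> \<open>The first LMI is stated for each p in \<open>PP\<close> and gives nothing if
    there is none; then the dissipation inequality is vacuous and any margins do.\<close>
  proof (cases "PP = {}")
    case True
    then have "strictly_dissipative nx PP Acl Cz (\<lambda>x. x \<bullet> (minv P *\<^sub>v x)) c1 c2 \<gamma> 1 1"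
      using c1 c2 gamma by unfold_locales auto
    then show ?thesis by blast
  next
    case False
    then obtain p0 where p0: "p0 \<in> PP" by blast
    define J where "J = msqrt R * Ycal"
    define H where "H = hcat (msqrt Q * P) (0\<^sub>m nx (nx * np))"
    define E :: "real mat" where "E = hcat (1\<^sub>m nx) (0\<^sub>m nx (nx * np))"
    define G where "G = Xcal * FQ"
    have Xp: "Xp \<in> carrier_mat nx N"
      unfolding Xp_def N_def by (rule carrier_matI) (auto simp: Xplus_def)
    have Jc: "J \<in> carrier_mat nu m"
      unfolding J_def Ycal_def
      by (rule carrier_matI) (use SR Y in \<open>simp_all add: m_def algebra_simps\<close>)
    have Hc: "H \<in> carrier_mat nx m"
      unfolding H_def by (rule carrier_matI) (use SQ P in \<open>simp_all add: m_def algebra_simps\<close>)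
    have Ec: "E \<in> carrier_mat nx m"
      unfolding E_def by (rule carrier_matI) (simp_all add: m_def algebra_simps)
    have P0c: "P0 \<in> carrier_mat m m"
      unfolding P0_def blkdiag_def blockmat_def
      by (rule carrier_matI) (use P in \<open>simp_all add: m_def algebra_simps\<close>)
    have Gc: "G \<in> carrier_mat m m"
      unfolding G_def Xcal_def blkdiag_def blockmat_def
      by (rule carrier_matI) (use Xp FQ in \<open>simp_all add: m_def algebra_simps\<close>)
    have Weq: "W = blockmat
     [[P0, transpose_mat G, transpose_mat H, transpose_mat J, 0\<^sub>m m nx],
      [G, P0, 0\<^sub>m m nx, 0\<^sub>m m nu, transpose_mat E],
      [H, 0\<^sub>m nx m, \<gamma> \<cdot>\<^sub>m 1\<^sub>m nx, 0\<^sub>m nx nu, 0\<^sub>m nx nx],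
      [J, 0\<^sub>m nu m, 0\<^sub>m nu nx, \<gamma> \<cdot>\<^sub>m 1\<^sub>m nu, 0\<^sub>m nu nx],
      [0\<^sub>m nx m, E, 0\<^sub>m nx nx, 0\<^sub>m nx nu, \<gamma> \<cdot>\<^sub>m 1\<^sub>m nx]]"
      unfolding W_def G_def H_def J_def E_def ..
    have Wc: "W \<in> carrier_mat (2 * (nx * (1 + np)) + (2 * nx + nu)) (2 * (nx * (1 + np)) + (2 * nx + nu))"
      unfolding m_def[symmetric] Weq blockmat_def
      by (rule carrier_matI)
        (use P0c Gc Hc Jc Ec in \<open>simp_all add: carrier_matD[OF P0c] carrier_matD[OF Gc] carrier_matD[OF Hc]
          carrier_matD[OF Jc] carrier_matD[OF Ec]\<close>)
    obtain \<epsilon> where \<epsilon>: "\<epsilon> > 0"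
      "\<And>p a b c d e. p \<in> PP \<Longrightarrow> a \<in> carrier_vec nx \<Longrightarrow> b \<in> carrier_vec nx \<Longrightarrow> c \<in> carrier_vec nx \<Longrightarrow>
        d \<in> carrier_vec nu \<Longrightarrow> e \<in> carrier_vec nx \<Longrightarrow>
        \<epsilon> * (a \<bullet> a + b \<bullet> b + c \<bullet> c + d \<bullet> d + e \<bullet> e)
        \<le> ((a @\<^sub>v kron_vec p a) @\<^sub>v (b @\<^sub>v kron_vec p b) @\<^sub>v c @\<^sub>v d @\<^sub>v e) \<bullet>
          (W *\<^sub>v ((a @\<^sub>v kron_vec p a) @\<^sub>v (b @\<^sub>v kron_vec p b) @\<^sub>v c @\<^sub>v d @\<^sub>v e))"
      using full_block_lmi_imp_parameter_dependent_bound[OF Xi(1) Wc PPc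
          LMI1[rule_format, OF p0, unfolded L11_def L12_def L21_def L22_def]
          LMI2[rule_format, unfolded Delta_def]] by blast
    have Dc: "D \<in> carrier_mat (dim_row D) N"
      by (rule carrier_matI) (simp_all add: D_def Dp_def Umat_def N_def)
    have data_dim': "xd k \<in> carrier_vec nx \<and> ud k \<in> carrier_vec nu \<and> ps_d k \<in> carrier_vec np" if "k \<in> {1..Nd}" for k
      using data_dim that PPc by blast
    have form: "\<epsilon> * (a \<bullet> a + b \<bullet> b + c \<bullet> c + d \<bullet> d + e \<bullet> e)
      \<le> a \<bullet> (P *\<^sub>v a) + 2 * (b \<bullet> (Acl p *\<^sub>v (P *\<^sub>v a))) + b \<bullet> (P *\<^sub>v b)
        + 2 * (c \<bullet> (msqrt Q *\<^sub>v (P *\<^sub>v a))) + \<gamma> * (c \<bullet> c)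
        + 2 * (d \<bullet> (msqrt R *\<^sub>v (K p *\<^sub>v (P *\<^sub>v a)))) + \<gamma> * (d \<bullet> d)
        + 2 * (e \<bullet> b) + \<gamma> * (e \<bullet> e)"
      if pP: "p \<in> PP" and a: "a \<in> carrier_vec nx" and b: "b \<in> carrier_vec nx" and c: "c \<in> carrier_vec nx"
        and d: "d \<in> carrier_vec nu" and e: "e \<in> carrier_vec nx" for p a b c d e
    proof -
      have p: "p \<in> carrier_vec np" using PPc pP by blast
      let ?sa = "a @\<^sub>v kron_vec p a" and ?sb = "b @\<^sub>v kron_vec p b"
      note dims = carrier_vecD[OF p] carrier_vecD[OF a] carrier_vecD[OF b] carrier_matD[OF P(1)]
        carrier_matD[OF SQ] carrier_matD[OF SR] carrier_matD[OF Y(1)] carrier_matD[OF Y(2)]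
      have sa: "?sa \<in> carrier_vec m" and sb: "?sb \<in> carrier_vec m"
        by (rule carrier_vecI, simp add: dims m_def algebra_simps)+
      have Pa: "P *\<^sub>v a \<in> carrier_vec nx" by (rule mult_mat_vec_carrier[OF P(1) a])
      define u where "u = Y0 *\<^sub>v a + Ybar *\<^sub>v kron_vec p a"
      have Ku: "K p *\<^sub>v (P *\<^sub>v a) = u"
        using controller_mult_vec[OF P Y p a, folded K0_def Kbar_def, folded Kf_def, folded K_def]
        by (simp add: u_def)
      have u: "u \<in> carrier_vec nu" unfolding Ku[symmetric] by (rule mult_mat_vec_carrier[OF K Pa])
      \<comment> \<open>The zero block of \<open>P0\<close> discards p \<otimes> v, so no parameter
        dependence remains in the Lyapunov terms.\<close>
      have P0v: "(v @\<^sub>v kron_vec p v) \<bullet> (P0 *\<^sub>v (v @\<^sub>v kron_vec p v)) = v \<bullet> (P *\<^sub>v v)"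
        if v: "v \<in> carrier_vec nx" for v
      proof -
        have "P0 *\<^sub>v (v @\<^sub>v kron_vec p v) = (P *\<^sub>v v) @\<^sub>v 0\<^sub>v (nx * np)"
          unfolding P0_def blkdiag_def blockmat_def
          by (simp add: vcat_mult_vec hcat_mult_append dims carrier_vecD[OF v] zero_mat_mult_vec_dim
              add_zero_vec_dim mult.commute)
        moreover have "kron_vec p v \<bullet> 0\<^sub>v (nx * np) = 0"
          using carrier_vecD[OF v] by (simp add: scalar_prod_def)
        ultimately show ?thesis by (simp add: scalar_prod_append_dim dims carrier_vecD[OF v] mult.commute)
      qed
      have Hsa: "H *\<^sub>v ?sa = msqrt Q *\<^sub>v (P *\<^sub>v a)"
        unfolding H_def using assoc_mult_mat_vec[OF SQ P(1) a]
        by (simp add: hcat_mult_append dims zero_mat_mult_vec_dim add_zero_vec_dim mult.commute)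
      have Esb: "E *\<^sub>v ?sb = b"
        unfolding E_def
        by (simp add: hcat_mult_append dims zero_mat_mult_vec_dim add_zero_vec_dim one_mat_mult_vec_dim mult.commute)
      have Jsa: "J *\<^sub>v ?sa = msqrt R *\<^sub>v u"
      proof -
        have Yc: "Ycal \<in> carrier_mat nu m"
          unfolding Ycal_def by (rule carrier_matI) (simp_all add: dims m_def algebra_simps)
        have "Ycal *\<^sub>v ?sa = u"
          unfolding Ycal_def u_def by (simp add: hcat_mult_append dims mult.commute)
        then show ?thesis unfolding J_def using assoc_mult_mat_vec[OF SR Yc sa] by simp
      qed
      let ?f = "FF *\<^sub>v (a @\<^sub>v kron_vec p a @\<^sub>v kron_vec p (kron_vec p a))"
      have f: "?f \<in> carrier_vec N"
        by (rule mult_mat_vec_carrier[OF FF], rule carrier_vecI) (simp add: dims algebra_simps power2_eq_square)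
      \<comment> \<open>The combination \<open>?f\<close> of data columns imitates a sample at state
        P a, scheduling p and feedback input u, so X_+ maps it to the closed-loop successor of P
        a.\<close>
      have "D *\<^sub>v ?f = (P *\<^sub>v a) @\<^sub>v kron_vec p (P *\<^sub>v a) @\<^sub>v u @\<^sub>v kron_vec p u"
        unfolding u_def by (rule decomposed_data_image[OF P(1) Y Dc FF p a D_eq])
      then have "Xp *\<^sub>v ?f = aff A np p *\<^sub>v (P *\<^sub>v a) + aff B np p *\<^sub>v u"
        unfolding Xp_def D_def
        using data_equation[where A = A and B = B and xd = xd and ud = ud and ps_d = ps_d and np = np and Nd = Nd, OF ABd data_dim' data_traj[rule_format] f[unfolded N_def] Pa u p] by blast
      also have "\<dots> = Acl p *\<^sub>v (P *\<^sub>v a)"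
        unfolding Acl_def add_mult_distrib_mat_vec[OF affA mult_carrier_mat[OF affB K] Pa]
          assoc_mult_mat_vec[OF affB K Pa] Ku ..
      finally have Xf: "Xp *\<^sub>v ?f = Acl p *\<^sub>v (P *\<^sub>v a)" .
      have Gsa: "?sb \<bullet> (G *\<^sub>v ?sa) = b \<bullet> (Acl p *\<^sub>v (P *\<^sub>v a))"
        unfolding Xf[symmetric] G_def Xcal_def
        by (rule lifted_bilinear_form[OF Xp FQ FF p a b FF_eq[rule_format, OF pP]])
      show ?thesis
        using \<epsilon>(2)[OF pP a b c d e]
        unfolding Weq performance_quadratic_form[OF P0c Gc Hc Jc Ec sa sb c d e]
          P0v[OF a] P0v[OF b] Gsa Hsa Jsa Esb Ku .
    qed
    have "strictly_dissipative nx PP Acl Cz (\<lambda>x. x \<bullet> (minv P *\<^sub>v x)) c1 c2 \<gamma> \<epsilon> (\<epsilon> / c3)"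
    proof
      fix p x w :: "real vec"
      assume pP: "p \<in> PP" and x: "x \<in> carrier_vec nx" and w: "w \<in> carrier_vec nx"
      let ?a = "minv P *\<^sub>v x"
      have a: "?a \<in> carrier_vec nx" by (rule mult_mat_vec_carrier[OF inv(1) x])
      have "P *\<^sub>v ?a = (P * minv P) *\<^sub>v x" by (rule assoc_mult_mat_vec[OF P(1) inv(1) x, symmetric])
      then have "P *\<^sub>v ?a = x" unfolding inv(2) using x by simp
      then have "x \<bullet> x \<le> c3 * (?a \<bullet> ?a)" using c3(2)[OF a] by simp
      then have "\<epsilon> / c3 * (x \<bullet> x) \<le> \<epsilon> / c3 * (c3 * (?a \<bullet> ?a))"
        using \<epsilon>(1) c3(1) by (intro mult_left_mono) auto
      then have "\<epsilon> / c3 * (x \<bullet> x) \<le> \<epsilon> * (?a \<bullet> ?a)" using c3(1) by simp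
      then show "(Acl p *\<^sub>v x + w) \<bullet> (minv P *\<^sub>v (Acl p *\<^sub>v x + w)) + ((Cz p *\<^sub>v x) \<bullet> (Cz p *\<^sub>v x)) / \<gamma>
          \<le> x \<bullet> ?a + (\<gamma> - \<epsilon>) * (w \<bullet> w) - \<epsilon> / c3 * (x \<bullet> x)"
        using dissipation_inequality[OF P K AK SQ SR gamma \<epsilon>(1) x w form[OF pP a]]
        unfolding Cz_def by linarith
    qed (use c1 c2 c3(1) gamma \<epsilon>(1) AK in auto)
    then show ?thesis by blast
  qed
  then obtain \<epsilon> \<delta> where "strictly_dissipative nx PP Acl Cz (\<lambda>x. x \<bullet> (minv P *\<^sub>v x)) c1 c2 \<gamma> \<epsilon> \<delta>" by blast
  then show ?thesis
    using strictly_dissipative.stabilizing strictly_dissipative.l2_gain_less by blast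
qed

end
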